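(* Let $G$ be a loopless graph (multigraph, parallel edges allowed) with maximum degree $\Delta$ and chromatic index $\chi'(G)\geq \Delta+2$. Let $\varphi$ be a partial $k$-edge-colouring of $G$ with $k\geq \Delta+1$ colours, and let $e_0$ be an edge left uncoloured by $\varphi$. Fix $T$ to be any maximal $\varphi$-Tashkinov tree starting at $e_0$ (so $V(T)=W^{\varphi}_{e_0}$). If none of the following statements is true: \begin{enumerate} \item[(1)] there is a sequence of Kempe changes transforming $\varphi$ into a partial $k$-edge-colouring $\varphi'$ in which the two ends of $e_0$ have a common missing colour; \item[(2)] there is a sequence of Kempe changes transforming $\varphi$ into a partial $k$-edge-colouring $\varphi'$ with $|W^{\varphi'}_{e_0}|>|W^{\varphi}_{e_0}|$; \item[(3)] $\chi'(G)\geq \lceil\rho(G[W^{\varphi}_{e_0}])\rceil > k$; \end{enumerate} then all of the following statements are true: \begin{enumerate} \item[(a)] $W^{\varphi}_{e_0}$ is $\varphi$-elementary and has at least one defective colour, and each defective colour appears on an odd number of edges between $W^{\varphi}_{e_0}$ and $V(G)\setminus W^{\varphi}_{e_0}$. \item[(b)] If $\beta\in \mathcal{M}^{\varphi}_{e_0}\setminus \mathcal{U}^{\varphi}_T$ and $\alpha\in\mathcal{D}^{\varphi}_{e_0}$, then the maximal $(\alpha,\beta)$-alternating path $P_{\alpha,\beta}$ that starts in $W^{\varphi}_{e_0}$ (at the vertex of $W^{\varphi}_{e_0}$ missing $\beta$) contains all edges coloured $\alpha$ having exactly one end in $W^{\varphi}_{e_0}$. Moreover, if $w_1,w_2$ are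 the first two vertices of $P_{\alpha,\beta}$ that are not in $W^{\varphi}_{e_0}$, then $W^{\varphi}_{e_0}\cup\{w_1,w_2\}$ is $\varphi$-elementary. \item[(c)] With $\alpha,\beta,P_{\alpha,\beta},w_1$ as in (b), let $Q_{\alpha,\beta}$ be the maximal-length segment of $P_{\alpha,\beta}$ which starts at $w_1$ and contains no vertices of $W^{\varphi}_{e_0}$. Then $W^{\varphi}_{e_0}\cup V(Q_{\alpha,\beta})$ is $\varphi$-elementary. \end{enumerate}
   Context: A partial $k$-edge-colouring of $G$ assigns to some edges colours from $\{1,\dots,k\}$ so that adjacent edges get different colours. A colour is missing at a vertex $v$ if no edge incident to $v$ has that colour. For two colours $a,b$, the edges coloured $a$ or $b$ induce a subgraph whose components are paths or even cycles; a Kempe change swaps $a$ and $b$ on one such component. An $(\alpha,\beta)$-alternating path is a path whose edges are alternately coloured $\alpha$ and $\beta$. The set $W^{\varphi}_{e_0}\subseteq V(G)$ is defined recursively: the two ends of $e_0$ are in it; a vertex $v$ is added if for some colour $\gamma$ there is an edge $e_v$ coloured $\gamma$ joining a vertex already in the set to $v$, and some vertex already in the set is missing $\gamma$. At any stage the current vertices together with $e_0$ and the edges $e_v$ used form a tree, called a $\varphi$-Tashkinov tree starting at $e_0$; a maximal such tree has vertex set exactly $W^{\varphi}_{e_0}$ (which is uniquely determined). A set $X\subseteq V(G)$ is $\varphi$-elementary if no two distinct vertices of $X$ have a common missing colour. A colour is defective for $W^{\varphi}_{e_0}$ if it occurs on more than one edge between $W^{\varphi}_{e_0}$ and $V(G)\setminus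 W^{\varphi}_{e_0}$. $\mathcal{M}^{\varphi}_{e_0}$ is the set of colours missing at at least one vertex of $W^{\varphi}_{e_0}$; $\mathcal{D}^{\varphi}_{e_0}$ is the set of defective colours for $W^{\varphi}_{e_0}$; $\mathcal{U}^{\varphi}_T$ is the set of colours appearing on the edges of $T$. For a graph $H$, $\rho(H)=\max\{\tfrac{2|E(H[S])|}{|S|-1}: S\subseteq V(H),\ |S|\text{ odd},\ |S|\ge 3\}$. *)

theory Defs
  imports Complex_Main
begin

(* A loopless multigraph: vertex set V, edge set E (edges are abstract objects,
   so parallel edges are allowed), and an endpoint map assigning to each edge
   a set of exactly two distinct vertices. *)
definition loopless_multigraph :: "'v set \<Rightarrow> 'e set \<Rightarrow> ('e \<Rightarrow> 'v set) \<Rightarrow> bool" where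
  "loopless_multigraph V E ends \<longleftrightarrow>
     finite V \<and> finite E \<and> (\<forall>e\<in>E. ends e \<subseteq> V \<and> card (ends e) = 2)"

definition degree :: "'e set \<Rightarrow> ('e \<Rightarrow> 'v set) \<Rightarrow> 'v \<Rightarrow> nat" where
  "degree E ends v = card {e\<in>E. v \<in> ends e}"

definition max_degree :: "'v set \<Rightarrow> 'e set \<Rightarrow> ('e \<Rightarrow> 'v set) \<Rightarrow> nat" where
  "max_degree V E ends = Max (insert 0 (degree E ends ` V))"

definition partial_edge_colouring ::
  "'e set \<Rightarrow> ('e \<Rightarrow> 'v set) \<Rightarrow> nat \<Rightarrow> ('e \<Rightarrow> nat option) \<Rightarrow> bool" where
  "partial_edge_colouring E ends k \<phi> \<longleftrightarrow>
     (\<forall>e\<in>E. \<forall>c. \<phi> e = Some c \<longrightarrow> c \<in> {1..k}) \<and>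
     (\<forall>e\<in>E. \<forall>f\<in>E. e \<noteq> f \<and> ends e \<inter> ends f \<noteq> {} \<and> \<phi> e \<noteq> None \<longrightarrow> \<phi> e \<noteq> \<phi> f)"

definition chromatic_index :: "'e set \<Rightarrow> ('e \<Rightarrow> 'v set) \<Rightarrow> nat" where
  "chromatic_index E ends =
     (LEAST k. \<exists>\<phi>. partial_edge_colouring E ends k \<phi> \<and> (\<forall>e\<in>E. \<phi> e \<noteq> None))"

definition missing ::
  "'e set \<Rightarrow> ('e \<Rightarrow> 'v set) \<Rightarrow> nat \<Rightarrow> ('e \<Rightarrow> nat option) \<Rightarrow> nat \<Rightarrow> 'v \<Rightarrow> bool" where
  "missing E ends k \<phi> c v \<longleftrightarrow> c \<in> {1..k} \<and> \<not> (\<exists>e\<in>E. v \<in> ends e \<and> \<phi> e = Some c)"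

definition ab_edges :: "'e set \<Rightarrow> ('e \<Rightarrow> nat option) \<Rightarrow> nat \<Rightarrow> nat \<Rightarrow> 'e set" where
  "ab_edges E \<phi> a b = {e\<in>E. \<phi> e = Some a \<or> \<phi> e = Some b}"

definition ab_component ::
  "'e set \<Rightarrow> ('e \<Rightarrow> 'v set) \<Rightarrow> ('e \<Rightarrow> nat option) \<Rightarrow> nat \<Rightarrow> nat \<Rightarrow> 'e \<Rightarrow> 'e set" where
  "ab_component E ends \<phi> a b e =
     {f. (e, f) \<in> ({(g, h). g \<in> ab_edges E \<phi> a b \<and> h \<in> ab_edges E \<phi> a b \<and> ends g \<inter> ends h \<noteq> {}})\<^sup>*}"

definition swap_on :: "'e set \<Rightarrow> nat \<Rightarrow> nat \<Rightarrow> ('e \<Rightarrow> nat option) \<Rightarrow> 'e \<Rightarrow> nat option" where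
  "swap_on C a b \<phi> = (\<lambda>f. if f \<in> C then (if \<phi> f = Some a then Some b else Some a) else \<phi> f)"

definition kempe_change ::
  "'e set \<Rightarrow> ('e \<Rightarrow> 'v set) \<Rightarrow> nat \<Rightarrow> ('e \<Rightarrow> nat option) \<Rightarrow> ('e \<Rightarrow> nat option) \<Rightarrow> bool" where
  "kempe_change E ends k \<phi> \<phi>' \<longleftrightarrow>
     (\<exists>a b e. a \<in> {1..k} \<and> b \<in> {1..k} \<and> a \<noteq> b \<and> e \<in> ab_edges E \<phi> a b \<and>
        \<phi>' = swap_on (ab_component E ends \<phi> a b e) a b \<phi>)"

inductive_set tashkinov_W ::
  "'e set \<Rightarrow> ('e \<Rightarrow> 'v set) \<Rightarrow> nat \<Rightarrow> ('e \<Rightarrow> nat option) \<Rightarrow> 'e \<Rightarrow> 'v set"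
  for E ends k \<phi> e0 where
  base: "x \<in> ends e0 \<Longrightarrow> x \<in> tashkinov_W E ends k \<phi> e0"
| step: "\<lbrakk> x \<in> tashkinov_W E ends k \<phi> e0; e \<in> E; ends e = {x, v}; \<phi> e = Some \<gamma>;
           y \<in> tashkinov_W E ends k \<phi> e0; missing E ends k \<phi> \<gamma> y \<rbrakk>
         \<Longrightarrow> v \<in> tashkinov_W E ends k \<phi> e0"

(* A Tashkinov tree starting at e0, given as the list of added pairs (e_v, v)
   in order of addition. *)
definition tree_vertices :: "('e \<Rightarrow> 'v set) \<Rightarrow> 'e \<Rightarrow> ('e \<times> 'v) list \<Rightarrow> 'v set" where
  "tree_vertices ends e0 ts = ends e0 \<union> snd ` set ts"

definition tashkinov_tree ::
  "'e set \<Rightarrow> ('e \<Rightarrow> 'v set) \<Rightarrow> nat \<Rightarrow> ('e \<Rightarrow> nat option) \<Rightarrow> 'e \<Rightarrow> ('e \<times> 'v) list \<Rightarrow> bool" where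
  "tashkinov_tree E ends k \<phi> e0 ts \<longleftrightarrow> e0 \<in> E \<and>
     (\<forall>i < length ts. let e = fst (ts ! i); v = snd (ts ! i);
                           X = tree_vertices ends e0 (take i ts) in
        e \<in> E \<and> v \<notin> X \<and> (\<exists>x\<in>X. ends e = {x, v}) \<and>
        (\<exists>\<gamma>. \<phi> e = Some \<gamma> \<and> (\<exists>y\<in>X. missing E ends k \<phi> \<gamma> y)))"

definition maximal_tashkinov_tree ::
  "'e set \<Rightarrow> ('e \<Rightarrow> 'v set) \<Rightarrow> nat \<Rightarrow> ('e \<Rightarrow> nat option) \<Rightarrow> 'e \<Rightarrow> ('e \<times> 'v) list \<Rightarrow> bool" where
  "maximal_tashkinov_tree E ends k \<phi> e0 ts \<longleftrightarrow>
     tashkinov_tree E ends k \<phi> e0 ts \<and> \<not> (\<exists>e v. tashkinov_tree E ends k \<phi> e0 (ts @ [(e, v)]))"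

definition tree_colours :: "('e \<Rightarrow> nat option) \<Rightarrow> 'e \<Rightarrow> ('e \<times> 'v) list \<Rightarrow> nat set" where
  "tree_colours \<phi> e0 ts = {c. \<exists>e \<in> insert e0 (fst ` set ts). \<phi> e = Some c}"

definition elementary ::
  "'e set \<Rightarrow> ('e \<Rightarrow> 'v set) \<Rightarrow> nat \<Rightarrow> ('e \<Rightarrow> nat option) \<Rightarrow> 'v set \<Rightarrow> bool" where
  "elementary E ends k \<phi> X \<longleftrightarrow>
     (\<forall>x\<in>X. \<forall>y\<in>X. x \<noteq> y \<longrightarrow> \<not> (\<exists>c. missing E ends k \<phi> c x \<and> missing E ends k \<phi> c y))"

definition boundary_edges ::
  "'e set \<Rightarrow> ('e \<Rightarrow> 'v set) \<Rightarrow> ('e \<Rightarrow> nat option) \<Rightarrow> 'v set \<Rightarrow> nat \<Rightarrow> 'e set" where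
  "boundary_edges E ends \<phi> X c = {e\<in>E. \<phi> e = Some c \<and> card (ends e \<inter> X) = 1}"

definition defective ::
  "'e set \<Rightarrow> ('e \<Rightarrow> 'v set) \<Rightarrow> ('e \<Rightarrow> nat option) \<Rightarrow> 'v set \<Rightarrow> nat \<Rightarrow> bool" where
  "defective E ends \<phi> X c \<longleftrightarrow> card (boundary_edges E ends \<phi> X c) > 1"

definition missing_colours ::
  "'e set \<Rightarrow> ('e \<Rightarrow> 'v set) \<Rightarrow> nat \<Rightarrow> ('e \<Rightarrow> nat option) \<Rightarrow> 'v set \<Rightarrow> nat set" where
  "missing_colours E ends k \<phi> X = {c. \<exists>v\<in>X. missing E ends k \<phi> c v}"

definition defective_colours ::
  "'e set \<Rightarrow> ('e \<Rightarrow> 'v set) \<Rightarrow> ('e \<Rightarrow> nat option) \<Rightarrow> 'v set \<Rightarrow> nat set" where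
  "defective_colours E ends \<phi> X = {c. defective E ends \<phi> X c}"

(* rho(H); convention rho(H) = 0 if H has fewer than 3 vertices *)
definition rho :: "'v set \<Rightarrow> 'e set \<Rightarrow> ('e \<Rightarrow> 'v set) \<Rightarrow> real" where
  "rho V E ends =
     (let R = {2 * real (card {e\<in>E. ends e \<subseteq> S}) / (real (card S) - 1) | S.
                 S \<subseteq> V \<and> odd (card S) \<and> card S \<ge> 3}
      in if R = {} then 0 else Max R)"

definition induced_edges :: "'e set \<Rightarrow> ('e \<Rightarrow> 'v set) \<Rightarrow> 'v set \<Rightarrow> 'e set" where
  "induced_edges E ends X = {e\<in>E. ends e \<subseteq> X}"

definition alt_path ::
  "'e set \<Rightarrow> ('e \<Rightarrow> 'v set) \<Rightarrow> ('e \<Rightarrow> nat option) \<Rightarrow> nat \<Rightarrow> nat \<Rightarrow> 'v list \<Rightarrow> 'e list \<Rightarrow> bool" where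
  "alt_path E ends \<phi> \<alpha> \<beta> vs es \<longleftrightarrow>
     length vs = Suc (length es) \<and> distinct vs \<and>
     (\<forall>i < length es. es ! i \<in> E \<and> ends (es ! i) = {vs ! i, vs ! Suc i} \<and>
        (\<phi> (es ! i) = Some \<alpha> \<or> \<phi> (es ! i) = Some \<beta>)) \<and>
     (\<forall>i. Suc i < length es \<longrightarrow> \<phi> (es ! i) \<noteq> \<phi> (es ! Suc i))"

definition maximal_alt_path_from ::
  "'e set \<Rightarrow> ('e \<Rightarrow> 'v set) \<Rightarrow> ('e \<Rightarrow> nat option) \<Rightarrow> nat \<Rightarrow> nat \<Rightarrow> 'v \<Rightarrow> 'v list \<Rightarrow> 'e list \<Rightarrow> bool" where
  "maximal_alt_path_from E ends \<phi> \<alpha> \<beta> u vs es \<longleftrightarrow>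
     alt_path E ends \<phi> \<alpha> \<beta> vs es \<and> vs ! 0 = u \<and>
     \<not> (\<exists>w e. alt_path E ends \<phi> \<alpha> \<beta> (vs @ [w]) (es @ [e])) \<and>
     \<not> (\<exists>w e. alt_path E ends \<phi> \<alpha> \<beta> (w # vs) (e # es))"

end

theory Submission
  imports Defs
begin

text \<open>
  Tashkinov's theorem holds with Kempe changes alone, the uncoloured edge \<open>e0\<close> staying fixed. Among all
  Tashkinov trees of all Kempe-equivalent colourings with two vertices missing a common colour, take
  one whose final path \<open>y p, \<dots>, y n\<close> starts as early as possible, and then of least size. Only the last
  vertex conflicts with another one, \<open>y r\<close>. If \<open>p \<le> r\<close>, a swap moves the conflict from \<open>y r\<close> to
  \<open>y (r + 1)\<close>, until \<open>r = n - 1\<close>, where recolouring the last edge shortens the tree. If \<open>r < p\<close>, there are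
  more missing colours than tree edges, so swaps make the common colour one that is not used on the
  tree up to \<open>y p\<close>; then it can be moved to \<open>y p\<close>, or, if \<open>p = n\<close>, the vertex \<open>y (n - 1)\<close> can be dropped.

  Hence \<open>W\<close> is elementary, and counting the edges of each colour inside \<open>W\<close> gives the parity statement
  and a defective colour. A boundary edge of a defective colour \<open>\<alpha>\<close> off the \<open>(\<alpha>, \<beta>)\<close>-path of \<open>u\<close> could
  be swapped to \<open>\<beta>\<close>, which would enlarge \<open>W\<close>. Consequently no Kempe-equivalent colouring for which \<open>T\<close> is
  still a tree lets the path end in its first excursion outside \<open>W\<close>. If a vertex of the excursion shared
  a missing colour with \<open>W\<close>, take the first such vertex: swaps make it share a missing colour with its
  predecessor on the path, and giving that colour to the edge between them would cut the path there.
\<close>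

section \<open>Kempe chains\<close>

locale multigraph =
  fixes V :: "'v set" and E :: "'e set" and ends :: "'e \<Rightarrow> 'v set" and k :: nat
  assumes multigraph: "loopless_multigraph V E ends"
begin

abbreviation miss :: "('e \<Rightarrow> nat option) \<Rightarrow> nat \<Rightarrow> 'v \<Rightarrow> bool" where
  "miss \<equiv> missing E ends k"

abbreviation proper :: "('e \<Rightarrow> nat option) \<Rightarrow> bool" where
  "proper \<equiv> partial_edge_colouring E ends k"

lemma finite_V: "finite V" and finite_E: "finite E"
  using multigraph by (auto simp: loopless_multigraph_def)

lemma ends_subset_V: "f \<in> E \<Longrightarrow> ends f \<subseteq> V"
  using multigraph by (auto simp: loopless_multigraph_def)

lemma card_ends: "f \<in> E \<Longrightarrow> card (ends f) = 2"
  using multigraph by (auto simp: loopless_multigraph_def)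

lemma ends_other:
  assumes "f \<in> E" "x \<in> ends f"
  obtains y where "y \<noteq> x" "ends f = {x, y}"
proof -
  obtain a b where "ends f = {a, b}" "a \<noteq> b"
    using card_ends[OF assms(1)] by (meson card_2_iff)
  thus ?thesis using assms(2) that[of a] that[of b] by auto
qed

lemma proper_range: "proper \<phi> \<Longrightarrow> f \<in> E \<Longrightarrow> \<phi> f = Some c \<Longrightarrow> c \<in> {1..k}"
  unfolding partial_edge_colouring_def by blast

lemma proper_unique:
  assumes "proper \<phi>" "f \<in> E" "g \<in> E" "x \<in> ends f" "x \<in> ends g" "\<phi> f = Some c" "\<phi> g = Some c"
  shows "f = g"
  using assms unfolding partial_edge_colouring_def by (metis disjoint_iff option.distinct(1))

lemma missD: "miss \<phi> c x \<Longrightarrow> f \<in> E \<Longrightarrow> x \<in> ends f \<Longrightarrow> \<phi> f \<noteq> Some c"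
  unfolding missing_def by blast

lemma miss_range: "miss \<phi> c x \<Longrightarrow> c \<in> {1..k}"
  unfolding missing_def by blast

lemma not_missE:
  assumes "\<not> miss \<phi> c x" "c \<in> {1..k}"
  obtains f where "f \<in> E" "x \<in> ends f" "\<phi> f = Some c"
  using assms unfolding missing_def by blast

section \<open>Kempe components as vertex sets\<close>

definition vcomp :: "('e \<Rightarrow> nat option) \<Rightarrow> nat \<Rightarrow> nat \<Rightarrow> 'v \<Rightarrow> 'v set" where
  "vcomp \<phi> a b v = {w. (v, w) \<in> {(x, y). \<exists>f\<in>ab_edges E \<phi> a b. x \<in> ends f \<and> y \<in> ends f}\<^sup>*}"

text \<open>Named by a vertex instead of an edge, the swap makes sense at every \<open>v\<close>:
  where no edge of either colour ends, the component is \<open>{v}\<close> and the swap is the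
  identity.\<close>

definition kswap :: "('e \<Rightarrow> nat option) \<Rightarrow> nat \<Rightarrow> nat \<Rightarrow> 'v \<Rightarrow> 'e \<Rightarrow> nat option" where
  "kswap \<phi> a b v =
     swap_on {f \<in> ab_edges E \<phi> a b. ends f \<inter> vcomp \<phi> a b v \<noteq> {}} a b \<phi>"

lemma vcomp_self: "v \<in> vcomp \<phi> a b v"
  by (simp add: vcomp_def)

lemma vcomp_sym: "w \<in> vcomp \<phi> a b v \<longleftrightarrow> v \<in> vcomp \<phi> a b w"
proof -
  have "sym {(x, y). \<exists>f\<in>ab_edges E \<phi> a b. x \<in> ends f \<and> y \<in> ends f}"
    by (auto simp: sym_def)
  from sym_rtrancl[OF this] show ?thesis unfolding vcomp_def by (auto dest: symD)
qed

lemma vcomp_trans: "w \<in> vcomp \<phi> a b v \<Longrightarrow> z \<in> vcomp \<phi> a b w \<Longrightarrow> z \<in> vcomp \<phi> a b v"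
  by (auto simp: vcomp_def)

lemma vcomp_closed:
  assumes "f \<in> ab_edges E \<phi> a b" "x \<in> ends f" "x \<in> vcomp \<phi> a b v" "y \<in> ends f"
  shows "y \<in> vcomp \<phi> a b v"
  using assms unfolding vcomp_def mem_Collect_eq
  by (elim rtrancl.rtrancl_into_rtrancl) blast

lemma vcomp_subset:
  assumes "v \<in> S"
    and "\<And>f x y. f \<in> ab_edges E \<phi> a b \<Longrightarrow> x \<in> ends f \<Longrightarrow> x \<in> S \<Longrightarrow> y \<in> ends f \<Longrightarrow> y \<in> S"
  shows "vcomp \<phi> a b v \<subseteq> S"
proof
  fix w assume "w \<in> vcomp \<phi> a b v"
  hence "(v, w) \<in> {(x, y). \<exists>f\<in>ab_edges E \<phi> a b. x \<in> ends f \<and> y \<in> ends f}\<^sup>*"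
    by (simp add: vcomp_def)
  thus "w \<in> S" by induction (use assms in blast)+
qed

lemma kswap_in:
  assumes "f \<in> E" "x \<in> ends f" "x \<in> vcomp \<phi> a b v"
  shows "kswap \<phi> a b v f =
    (if \<phi> f = Some a then Some b else if \<phi> f = Some b then Some a else \<phi> f)"
  using assms by (auto simp: kswap_def swap_on_def ab_edges_def)

lemma kswap_out:
  assumes "x \<in> ends f" "x \<notin> vcomp \<phi> a b v"
  shows "kswap \<phi> a b v f = \<phi> f"
  using assms by (auto simp: kswap_def swap_on_def dest: vcomp_closed)

lemma kswap_other: "\<phi> f \<noteq> Some a \<Longrightarrow> \<phi> f \<noteq> Some b \<Longrightarrow> kswap \<phi> a b v f = \<phi> f"
  by (auto simp: kswap_def swap_on_def ab_edges_def)

lemma kswap_ab: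
  "\<phi> f = Some a \<or> \<phi> f = Some b \<Longrightarrow> kswap \<phi> a b v f = Some a \<or> kswap \<phi> a b v f = Some b"
  by (auto simp: kswap_def swap_on_def)

lemma kswap_colour_other:
  "c \<noteq> a \<Longrightarrow> c \<noteq> b \<Longrightarrow> kswap \<phi> a b v f = Some c \<longleftrightarrow> \<phi> f = Some c"
  by (auto simp: kswap_def swap_on_def ab_edges_def)

lemma kswap_None: "kswap \<phi> a b v f = None \<longleftrightarrow> \<phi> f = None"
  by (auto simp: kswap_def swap_on_def ab_edges_def)

lemma miss_kswap_other: "c \<noteq> a \<Longrightarrow> c \<noteq> b \<Longrightarrow> miss (kswap \<phi> a b v) c x \<longleftrightarrow> miss \<phi> c x"
  by (simp add: missing_def kswap_colour_other)

lemma miss_kswap_out: "x \<notin> vcomp \<phi> a b v \<Longrightarrow> miss (kswap \<phi> a b v) c x \<longleftrightarrow> miss \<phi> c x"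
  unfolding missing_def using kswap_out[of x _ \<phi> a b v] by metis

lemma miss_kswap_in:
  assumes "x \<in> vcomp \<phi> a b v" "a \<in> {1..k}" "b \<in> {1..k}"
  shows "miss (kswap \<phi> a b v) a x \<longleftrightarrow> miss \<phi> b x"
    and "miss (kswap \<phi> a b v) b x \<longleftrightarrow> miss \<phi> a x"
  unfolding missing_def using assms kswap_in[OF _ _ assms(1)]
  by (auto split: if_splits)

text \<open>If an edge of one of the colours ends at \<open>v\<close>, the swapped edges are exactly
  the \<open>ab_component\<close> of that edge, a single Kempe change; otherwise nothing changes.
  The reflexive closure covers both.\<close>

lemma kswap_reachable:
  assumes "a \<in> {1..k}" "b \<in> {1..k}" "a \<noteq> b"
  shows "(kempe_change E ends k)\<^sup>*\<^sup>* \<phi> (kswap \<phi> a b v)"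
proof (cases "\<exists>f0\<in>ab_edges E \<phi> a b. v \<in> ends f0")
  case True
  then obtain f0 where f0: "f0 \<in> ab_edges E \<phi> a b" "v \<in> ends f0" by blast
  let ?R = "{(g, h). g \<in> ab_edges E \<phi> a b \<and> h \<in> ab_edges E \<phi> a b \<and> ends g \<inter> ends h \<noteq> {}}"
  have "ab_component E ends \<phi> a b f0 = {f \<in> ab_edges E \<phi> a b. ends f \<inter> vcomp \<phi> a b v \<noteq> {}}"
  proof (intro set_eqI iffI)
    fix f assume "f \<in> ab_component E ends \<phi> a b f0"
    hence "(f0, f) \<in> ?R\<^sup>*" by (simp add: ab_component_def)
    thus "f \<in> {f \<in> ab_edges E \<phi> a b. ends f \<inter> vcomp \<phi> a b v \<noteq> {}}"
    proof induction
      case base thus ?case using f0 vcomp_self by blast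
    next
      case (step g h)
      then obtain x where "x \<in> ends g" "x \<in> ends h" by blast
      with step show ?case using vcomp_closed[of g \<phi> a b _ v x] by blast
    qed
  next
    fix f assume f: "f \<in> {f \<in> ab_edges E \<phi> a b. ends f \<inter> vcomp \<phi> a b v \<noteq> {}}"
    then obtain w where w: "w \<in> ends f" "w \<in> vcomp \<phi> a b v" by blast
    from w(2) have "(v, w) \<in> {(x, y). \<exists>f\<in>ab_edges E \<phi> a b. x \<in> ends f \<and> y \<in> ends f}\<^sup>*"
      by (simp add: vcomp_def)
    hence "\<forall>f\<in>ab_edges E \<phi> a b. w \<in> ends f \<longrightarrow> (f0, f) \<in> ?R\<^sup>*"
    proof induction
      case base
      have "(f0, f) \<in> ?R" if "f \<in> ab_edges E \<phi> a b" "v \<in> ends f" for f using that f0 by blast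
      thus ?case by blast
    next
      case (step x y)
      then obtain g where g: "g \<in> ab_edges E \<phi> a b" "x \<in> ends g" "y \<in> ends g" by blast
      hence "(f0, g) \<in> ?R\<^sup>*" using step by blast
      moreover have "(g, f) \<in> ?R" if "f \<in> ab_edges E \<phi> a b" "y \<in> ends f" for f
        using that g by blast
      ultimately show ?case by (meson rtrancl.rtrancl_into_rtrancl)
    qed
    thus "f \<in> ab_component E ends \<phi> a b f0" using f w by (simp add: ab_component_def)
  qed
  hence "kempe_change E ends k \<phi> (kswap \<phi> a b v)"
    unfolding kempe_change_def kswap_def using assms f0 by metis
  thus ?thesis by blast
next
  case False
  have "vcomp \<phi> a b v \<subseteq> {v}" by (rule vcomp_subset) (use False in auto)
  hence "kswap \<phi> a b v = \<phi>" using False by (fastforce simp: kswap_def swap_on_def)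
  thus ?thesis by simp
qed

text \<open>A component is closed under adjacency, so two adjacent edges with colours among
  \<open>a\<close> and \<open>b\<close> are swapped together or not at all.\<close>

lemma kempe_change_proper:
  assumes "kempe_change E ends k \<phi> \<phi>'" "proper \<phi>"
  shows "proper \<phi>' \<and> (\<forall>f. \<phi>' f = None \<longleftrightarrow> \<phi> f = None)"
proof -
  obtain a b f0 where ab: "a \<in> {1..k}" "b \<in> {1..k}" "f0 \<in> ab_edges E \<phi> a b"
    and eq: "\<phi>' = swap_on (ab_component E ends \<phi> a b f0) a b \<phi>"
    using assms(1) unfolding kempe_change_def by blast
  let ?R = "{(g, h). g \<in> ab_edges E \<phi> a b \<and> h \<in> ab_edges E \<phi> a b \<and> ends g \<inter> ends h \<noteq> {}}"
  let ?C = "ab_component E ends \<phi> a b f0"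
  have sub: "f \<in> ab_edges E \<phi> a b" if "f \<in> ?C" for f
  proof -
    have "(f0, f) \<in> ?R\<^sup>*" using that by (simp add: ab_component_def)
    thus ?thesis by induction (use ab in auto)
  qed
  have closed: "g \<in> ?C"
    if "f \<in> ?C" "g \<in> ab_edges E \<phi> a b" "ends f \<inter> ends g \<noteq> {}" for f g
  proof -
    have "(f, g) \<in> ?R" using that sub by blast
    thus ?thesis using that(1) unfolding ab_component_def
      by (auto intro: rtrancl.rtrancl_into_rtrancl)
  qed
  have "proper \<phi>'" unfolding partial_edge_colouring_def
  proof (intro conjI ballI allI impI)
    fix f c assume "f \<in> E" "\<phi>' f = Some c"
    thus "c \<in> {1..k}" using ab proper_range[OF assms(2), of f c]
      by (auto simp: eq swap_on_def split: if_splits)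
  next
    fix f g assume fg: "f \<in> E" "g \<in> E"
      and h: "f \<noteq> g \<and> ends f \<inter> ends g \<noteq> {} \<and> \<phi>' f \<noteq> None"
    have 1: "\<phi> f = \<phi> g \<Longrightarrow> \<phi> f = None"
      using assms(2) h fg unfolding partial_edge_colouring_def by blast
    have 2: "f \<in> ?C \<longleftrightarrow> g \<in> ?C" if "f \<in> ab_edges E \<phi> a b" "g \<in> ab_edges E \<phi> a b"
      using closed[of f g] closed[of g f] that h by blast
    show "\<phi>' f \<noteq> \<phi>' g"
      using 1 2 h fg sub[of f] sub[of g] unfolding eq swap_on_def ab_edges_def
      by (auto split: if_splits)
  qed
  moreover have "\<phi>' f = None \<longleftrightarrow> \<phi> f = None" for f
    using sub[of f] by (auto simp: eq swap_on_def ab_edges_def)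
  ultimately show ?thesis by blast
qed

lemma kempe_reachable_proper:
  assumes "(kempe_change E ends k)\<^sup>*\<^sup>* \<phi> \<phi>'" "proper \<phi>"
  shows "proper \<phi>' \<and> (\<forall>f. \<phi>' f = None \<longleftrightarrow> \<phi> f = None)"
  using assms by induction (auto dest: kempe_change_proper)

text \<open>A vertex of an alternating path already sees both colours on the path, unless it is an end,
  so the path can only be left at its last vertex.\<close>

lemma alt_path_absorbs_init:
  assumes \<phi>: "proper \<phi>" and P: "alt_path E ends \<phi> a b vs es"
    and fst: "miss \<phi> a (vs ! 0) \<or> miss \<phi> b (vs ! 0)"
    and f: "f \<in> ab_edges E \<phi> a b" "vs ! j \<in> ends f" and j: "j < length es"
  shows "f \<in> set es"
proof -
  have fE: "f \<in> E" and fc: "\<phi> f = Some a \<or> \<phi> f = Some b" using f by (auto simp: ab_edges_def)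
  have es: "es ! i \<in> E" "ends (es ! i) = {vs ! i, vs ! Suc i}"
    "\<phi> (es ! i) = Some a \<or> \<phi> (es ! i) = Some b" if "i < length es" for i
    using P that unfolding alt_path_def by auto
  have ej: "f = es ! j" if "\<phi> f = \<phi> (es ! j)"
    using proper_unique[OF \<phi> fE es(1)[OF j] f(2)] es[OF j] that by auto
  show ?thesis
  proof (cases j)
    case 0
    have "\<phi> f = \<phi> (es ! j)"
      using fc es(3)[OF j] fst missD[OF _ fE, of \<phi> _ "vs ! j"] missD[OF _ es(1)[OF j], of \<phi> _ "vs ! j"]
        f(2) es(2)[OF j] 0 by auto
    thus ?thesis using ej j by auto
  next
    case (Suc i)
    hence i: "i < length es" using j by simp
    have "\<phi> (es ! i) \<noteq> \<phi> (es ! j)" using P j Suc unfolding alt_path_def by auto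
    hence "\<phi> f = \<phi> (es ! i) \<or> \<phi> f = \<phi> (es ! j)" using es(3)[OF i] es(3)[OF j] fc by auto
    moreover have "f = es ! i" if "\<phi> f = \<phi> (es ! i)"
      using proper_unique[OF \<phi> fE es(1)[OF i] f(2)] es[OF i] that Suc by auto
    ultimately show ?thesis using ej i j by auto
  qed
qed

lemma alt_path_absorbs:
  assumes \<phi>: "proper \<phi>" and P: "alt_path E ends \<phi> a b vs es" and ne: "es \<noteq> []"
    and fst: "miss \<phi> a (vs ! 0) \<or> miss \<phi> b (vs ! 0)"
    and lst: "miss \<phi> a (vs ! length es) \<or> miss \<phi> b (vs ! length es)"
    and f: "f \<in> ab_edges E \<phi> a b" "x \<in> set vs" "x \<in> ends f"
  shows "f \<in> set es"
proof -
  obtain j where j: "j < length vs" "x = vs ! j" using f(2) by (metis in_set_conv_nth)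
  show ?thesis
  proof (cases "j < length es")
    case True thus ?thesis using alt_path_absorbs_init[OF \<phi> P fst f(1)] f(3) j by auto
  next
    case False
    hence jl: "j = length es" using j P by (simp add: alt_path_def)
    define i where "i = length es - 1"
    have i: "i < length es" "Suc i = j" using ne jl by (auto simp: i_def)
    have es: "es ! i \<in> E" "ends (es ! i) = {vs ! i, vs ! j}"
      "\<phi> (es ! i) = Some a \<or> \<phi> (es ! i) = Some b"
      using P i unfolding alt_path_def by auto
    have fE: "f \<in> E" and fc: "\<phi> f = Some a \<or> \<phi> f = Some b" using f by (auto simp: ab_edges_def)
    have "\<phi> f = \<phi> (es ! i)"
      using fc es(3) lst missD[OF _ fE, of \<phi> _ "vs ! j"] missD[OF _ es(1), of \<phi> _ "vs ! j"]
        f(3) j es(2) jl by auto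
    hence "f = es ! i" using proper_unique[OF \<phi> fE es(1) f(3)] es j by auto
    thus ?thesis using i by auto
  qed
qed

section \<open>Maximal alternating paths and the components they span\<close>

lemma alt_path_snoc:
  assumes P: "alt_path E ends \<phi> a b vs es" and f: "f \<in> ab_edges E \<phi> a b"
    and e: "ends f = {vs ! length es, w}" and w: "w \<notin> set vs"
    and c: "es \<noteq> [] \<Longrightarrow> \<phi> f \<noteq> \<phi> (es ! (length es - 1))"
  shows "alt_path E ends \<phi> a b (vs @ [w]) (es @ [f])"
proof -
  have len: "length vs = Suc (length es)" using P by (simp add: alt_path_def)
  have "(es @ [f]) ! i \<in> E \<and> ends ((es @ [f]) ! i) = {(vs @ [w]) ! i, (vs @ [w]) ! Suc i} \<and>
      (\<phi> ((es @ [f]) ! i) = Some a \<or> \<phi> ((es @ [f]) ! i) = Some b)" if "i < Suc (length es)" for i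
    using that P e f len unfolding alt_path_def ab_edges_def
    by (cases "i = length es") (auto simp: nth_append)
  moreover have "\<phi> ((es @ [f]) ! i) \<noteq> \<phi> ((es @ [f]) ! Suc i)" if "Suc i < Suc (length es)" for i
  proof (cases "Suc i = length es")
    case True
    hence "i = length es - 1" "es \<noteq> []" by auto
    thus ?thesis using True c by (auto simp: nth_append)
  next
    case False
    thus ?thesis using that P unfolding alt_path_def by (auto simp: nth_append)
  qed
  ultimately show ?thesis using P w unfolding alt_path_def by auto
qed

text \<open>A last vertex seeing both colours would offer an edge to continue with. Its far end is a
  new vertex: an edge back to the path is absorbed by the path, and the last vertex lies on no path
  edge but the last.\<close>

lemma maximal_alt_path_last:
  assumes \<phi>: "proper \<phi>" and P: "alt_path E ends \<phi> a b vs es"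
    and ab: "a \<in> {1..k}" "b \<in> {1..k}"
    and fst: "miss \<phi> a (vs ! 0) \<or> miss \<phi> b (vs ! 0)"
    and max: "\<not> (\<exists>w e. alt_path E ends \<phi> a b (vs @ [w]) (es @ [e]))"
  shows "miss \<phi> a (vs ! length es) \<or> miss \<phi> b (vs ! length es)"
proof (rule ccontr)
  assume neg: "\<not> ?thesis"
  let ?v = "vs ! length es"
  have len: "length vs = Suc (length es)" and dist: "distinct vs"
    using P by (auto simp: alt_path_def)
  have ne: "es \<noteq> []" using fst neg by (metis list.size(3))
  define i where "i = length es - 1"
  have i: "i < length es" "Suc i = length es" using ne by (auto simp: i_def)
  have es: "es ! i \<in> E" "ends (es ! i) = {vs ! i, ?v}" "\<phi> (es ! i) = Some a \<or> \<phi> (es ! i) = Some b"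
    using P i unfolding alt_path_def by auto
  obtain fa where fa: "fa \<in> E" "?v \<in> ends fa" "\<phi> fa = Some a" using neg ab not_missE by metis
  obtain fb where fb: "fb \<in> E" "?v \<in> ends fb" "\<phi> fb = Some b" using neg ab not_missE by metis
  have "\<exists>f. f \<in> ab_edges E \<phi> a b \<and> ?v \<in> ends f \<and> \<phi> f \<noteq> \<phi> (es ! i)"
  proof (cases "a = b")
    \<comment> \<open>The colours are not assumed distinct. With \<open>a = b\<close> alternation
      leaves a single edge, which contradicts the colour missing at its start.\<close>
    case True
    have "Suc 0 < length es \<Longrightarrow> \<phi> (es ! 0) \<noteq> \<phi> (es ! Suc 0)" using P unfolding alt_path_def by auto
    moreover have "Suc 0 < length es \<Longrightarrow> \<phi> (es ! 0) = Some a \<and> \<phi> (es ! Suc 0) = Some a"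
      using P True unfolding alt_path_def by (metis Suc_lessD)
    ultimately have "length es = 1" using i by fastforce
    hence "miss \<phi> a (vs ! 0) \<and> es ! 0 \<in> E \<and> vs ! 0 \<in> ends (es ! 0) \<and> \<phi> (es ! 0) = Some a"
      using es i True fst by auto
    thus ?thesis using missD by blast
  next
    case False
    thus ?thesis using fa fb es(3) unfolding ab_edges_def by auto
  qed
  then obtain f where f: "f \<in> ab_edges E \<phi> a b" "?v \<in> ends f" "\<phi> f \<noteq> \<phi> (es ! i)" by blast
  hence fE: "f \<in> E" by (simp add: ab_edges_def)
  obtain w where w: "w \<noteq> ?v" "ends f = {?v, w}" using ends_other[OF fE f(2)] by metis
  have "w \<notin> set vs"
  proof
    assume "w \<in> set vs"
    then obtain j where j: "j < length vs" "w = vs ! j" by (metis in_set_conv_nth)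
    hence "j < length es" using w(1) len by (metis less_SucE)
    hence "f \<in> set es" using alt_path_absorbs_init[OF \<phi> P fst f(1)] w(2) j by auto
    then obtain l where l: "l < length es" "f = es ! l" by (metis in_set_conv_nth)
    hence "?v \<in> {vs ! l, vs ! Suc l}" using P f(2) unfolding alt_path_def by auto
    hence "length es = l \<or> length es = Suc l"
      using dist len l by (auto simp: nth_eq_iff_index_eq)
    thus False using l f(3) i by auto
  qed
  hence "alt_path E ends \<phi> a b (vs @ [w]) (es @ [f])"
    using alt_path_snoc[OF P f(1) w(2)] f(3) i_def by auto
  thus False using max by blast
qed

lemma alt_path_vcomp:
  assumes P: "alt_path E ends \<phi> a b vs es"
  shows "set vs \<subseteq> vcomp \<phi> a b (vs ! 0)"
proof -
  have "j < length vs \<Longrightarrow> vs ! j \<in> vcomp \<phi> a b (vs ! 0)" for j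
  proof (induction j)
    case 0 thus ?case by (simp add: vcomp_self)
  next
    case (Suc j)
    have "es ! j \<in> ab_edges E \<phi> a b" "ends (es ! j) = {vs ! j, vs ! Suc j}"
      using P Suc by (auto simp: alt_path_def ab_edges_def)
    thus ?case using Suc vcomp_closed by (metis Suc_lessD insertCI)
  qed
  thus ?thesis by (auto simp: in_set_conv_nth)
qed

lemma maximal_alt_path_vcomp:
  assumes \<phi>: "proper \<phi>" and P: "alt_path E ends \<phi> a b vs es"
    and fst: "miss \<phi> a (vs ! 0) \<or> miss \<phi> b (vs ! 0)"
    and lst: "miss \<phi> a (vs ! length es) \<or> miss \<phi> b (vs ! length es)"
    and ne: "es \<noteq> []"
  shows "vcomp \<phi> a b (vs ! 0) = set vs"
proof
  have len: "length vs = Suc (length es)" using P by (simp add: alt_path_def)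
  show "vcomp \<phi> a b (vs ! 0) \<subseteq> set vs"
  proof (rule vcomp_subset)
    show "vs ! 0 \<in> set vs" using len by simp
    fix f x y assume f: "f \<in> ab_edges E \<phi> a b" "x \<in> ends f" "x \<in> set vs" "y \<in> ends f"
    have "f \<in> set es" using alt_path_absorbs[OF \<phi> P ne fst lst f(1,3,2)] .
    then obtain l where "l < length es" "f = es ! l" by (metis in_set_conv_nth)
    hence "ends f \<subseteq> set vs" using P len unfolding alt_path_def by auto
    thus "y \<in> set vs" using f by blast
  qed
qed (rule alt_path_vcomp[OF P])

lemma ex_maximal_alt_path:
  obtains vs es where "alt_path E ends \<phi> a b vs es" "vs ! 0 = x"
    "\<not> (\<exists>w e. alt_path E ends \<phi> a b (vs @ [w]) (es @ [e]))"
proof -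
  let ?Q = "\<lambda>p. alt_path E ends \<phi> a b (fst p) (snd p) \<and> fst p ! 0 = x"
  have init: "?Q ([x], [])" by (simp add: alt_path_def)
  \<comment> \<open>The start \<open>x\<close> of a trivial path need not lie in \<open>V\<close>,
    hence \<open>insert x V\<close>.\<close>
  have bound: "\<forall>p. ?Q p \<longrightarrow> length (fst p) < Suc (card (insert x V))"
  proof (intro allI impI)
    fix p assume p: "?Q p"
    obtain vs es where pe: "p = (vs, es)" by force
    hence P: "alt_path E ends \<phi> a b vs es" "vs ! 0 = x" using p by auto
    have "set vs \<subseteq> insert x V"
    proof
      fix w assume "w \<in> set vs"
      then obtain j where j: "j < length vs" "w = vs ! j" by (metis in_set_conv_nth)
      show "w \<in> insert x V"
      proof (cases j)
        case 0 thus ?thesis using P j by simp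
      next
        case (Suc i)
        hence "es ! i \<in> E" "w \<in> ends (es ! i)" using P j unfolding alt_path_def by auto
        thus ?thesis using ends_subset_V by blast
      qed
    qed
    moreover have "distinct vs" using P by (simp add: alt_path_def)
    ultimately have "length vs \<le> card (insert x V)"
      by (metis card_mono distinct_card finite_V finite_insert)
    thus "length (fst p) < Suc (card (insert x V))" using pe by simp
  qed
  obtain p where p: "?Q p" and mx: "\<forall>q. ?Q q \<longrightarrow> length (fst q) \<le> length (fst p)"
    using ex_has_greatest_nat[of ?Q "([x], [])" "\<lambda>p. length (fst p)" "Suc (card (insert x V))"]
      init bound by force
  have "\<not> (\<exists>w e. alt_path E ends \<phi> a b (fst p @ [w]) (snd p @ [e]))"
  proof
    assume "\<exists>w e. alt_path E ends \<phi> a b (fst p @ [w]) (snd p @ [e])"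
    then obtain w e where we: "alt_path E ends \<phi> a b (fst p @ [w]) (snd p @ [e])" by blast
    have "(fst p @ [w]) ! 0 = x" using p by (simp add: alt_path_def nth_append)
    hence "length (fst (fst p @ [w], snd p @ [e])) \<le> length (fst p)"
      using mx we by (metis fst_conv snd_conv)
    thus False by simp
  qed
  thus ?thesis using that p by blast
qed

lemma vcomp_chain:
  assumes \<phi>: "proper \<phi>" and ab: "a \<in> {1..k}" "b \<in> {1..k}" and x: "miss \<phi> a x \<or> miss \<phi> b x"
  obtains vs es where "alt_path E ends \<phi> a b vs es" "vs ! 0 = x" "vcomp \<phi> a b x = set vs"
proof -
  obtain vs es where P: "alt_path E ends \<phi> a b vs es" "vs ! 0 = x"
    and max: "\<not> (\<exists>w e. alt_path E ends \<phi> a b (vs @ [w]) (es @ [e]))"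
    using ex_maximal_alt_path by blast
  have fst: "miss \<phi> a (vs ! 0) \<or> miss \<phi> b (vs ! 0)" using x P by simp
  have "vcomp \<phi> a b x = set vs"
  proof (cases "es = []")
    case True
    hence vs: "vs = [x]" using P by (auto simp: alt_path_def length_Suc_conv)
    have "\<not> (\<exists>f\<in>ab_edges E \<phi> a b. x \<in> ends f)"
    proof
      assume "\<exists>f\<in>ab_edges E \<phi> a b. x \<in> ends f"
      then obtain f where f: "f \<in> ab_edges E \<phi> a b" "x \<in> ends f" by blast
      hence "f \<in> E" by (simp add: ab_edges_def)
      then obtain w where "w \<noteq> x" "ends f = {x, w}" using ends_other f by metis
      hence "alt_path E ends \<phi> a b (vs @ [w]) (es @ [f])"
        using alt_path_snoc[OF P(1) f(1)] True vs by auto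
      thus False using max by blast
    qed
    hence "vcomp \<phi> a b x \<subseteq> {x}" by (intro vcomp_subset) auto
    thus ?thesis using vs vcomp_self by auto
  next
    case False
    show ?thesis
      using maximal_alt_path_vcomp[OF \<phi> P(1) fst maximal_alt_path_last[OF \<phi> P(1) ab fst max] False] P(2)
      by simp
  qed
  thus ?thesis using that P by blast
qed

text \<open>The component of \<open>x\<close> is a path beginning at \<open>x\<close>. Its inner
  vertices see both colours, so besides \<open>x\<close> only the last vertex can miss one.\<close>

lemma vcomp_two_ends:
  assumes \<phi>: "proper \<phi>" and ab: "a \<in> {1..k}" "b \<in> {1..k}" "a \<noteq> b"
    and x: "miss \<phi> a x \<or> miss \<phi> b x" and y: "miss \<phi> a y \<or> miss \<phi> b y"
    and z: "miss \<phi> a z \<or> miss \<phi> b z"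
    and ne: "x \<noteq> y" "x \<noteq> z" "y \<noteq> z" and yx: "y \<in> vcomp \<phi> a b x"
  shows "z \<notin> vcomp \<phi> a b x"
proof
  assume zx: "z \<in> vcomp \<phi> a b x"
  obtain vs es where P: "alt_path E ends \<phi> a b vs es" "vs ! 0 = x" "vcomp \<phi> a b x = set vs"
    using vcomp_chain[OF \<phi> ab(1,2) x] by blast
  have len: "length vs = Suc (length es)" using P by (simp add: alt_path_def)
  have last: "w = vs ! length es" if w: "w \<in> set vs" "miss \<phi> a w \<or> miss \<phi> b w" "w \<noteq> x" for w
  proof -
    obtain j where j: "j < length vs" "w = vs ! j" using w by (metis in_set_conv_nth)
    obtain i where i: "j = Suc i" using j w P by (cases j) auto
    have "\<not> Suc i < length es"
    proof
      assume *: "Suc i < length es"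
      hence "\<phi> (es ! i) \<noteq> \<phi> (es ! Suc i)" "es ! i \<in> E" "es ! Suc i \<in> E"
        "w \<in> ends (es ! i)" "w \<in> ends (es ! Suc i)"
        "\<phi> (es ! i) = Some a \<or> \<phi> (es ! i) = Some b"
        "\<phi> (es ! Suc i) = Some a \<or> \<phi> (es ! Suc i) = Some b"
        using P j i unfolding alt_path_def by auto
      thus False using w(2) missD by metis
    qed
    thus ?thesis using i j len by (metis less_SucE)
  qed
  show False using last[of y] last[of z] y z yx zx ne P by auto
qed

end

section \<open>Tashkinov's theorem\<close>

context multigraph
begin

lemma card_missing_ge:
  assumes "proper \<phi>"
  shows "k \<le> card {c. miss \<phi> c v} + card {f\<in>E. v \<in> ends f \<and> \<phi> f \<noteq> None}"
proof -
  let ?F = "{f\<in>E. v \<in> ends f \<and> \<phi> f \<noteq> None}"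
  have fin: "finite {c. miss \<phi> c v}" by (rule finite_subset[of _ "{1..k}"]) (auto simp: missing_def)
  have "{1..k} \<subseteq> {c. miss \<phi> c v} \<union> (\<lambda>f. the (\<phi> f)) ` ?F"
  proof
    fix c assume c: "c \<in> {1..k}"
    show "c \<in> {c. miss \<phi> c v} \<union> (\<lambda>f. the (\<phi> f)) ` ?F"
    proof (cases "miss \<phi> c v")
      case False
      then obtain f where "f \<in> E" "v \<in> ends f" "\<phi> f = Some c" using not_missE c by blast
      hence "f \<in> ?F" "the (\<phi> f) = c" by auto
      thus ?thesis by blast
    qed simp
  qed
  hence "card {1..k} \<le> card ({c. miss \<phi> c v} \<union> (\<lambda>f. the (\<phi> f)) ` ?F)"
    by (rule card_mono[rotated]) (use fin finite_E in auto)
  also have "\<dots> \<le> card {c. miss \<phi> c v} + card ((\<lambda>f. the (\<phi> f)) ` ?F)" by (rule card_Un_le)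
  also have "\<dots> \<le> card {c. miss \<phi> c v} + card ?F" using finite_E by (simp add: card_image_le)
  finally show ?thesis by simp
qed

lemma degree_le_max_degree: "v \<in> V \<Longrightarrow> degree E ends v \<le> max_degree V E ends"
  unfolding max_degree_def by (rule Max_ge) (use finite_V in auto)

lemma finite_missing: "finite {c. miss \<phi> c v}"
  by (rule finite_subset[of _ "{1..k}"]) (auto simp: missing_def)

lemma elementaryD:
  "elementary E ends k \<phi> X \<Longrightarrow> x \<in> X \<Longrightarrow> y \<in> X \<Longrightarrow> miss \<phi> c x \<Longrightarrow> miss \<phi> c y \<Longrightarrow> x = y"
  unfolding elementary_def by blast

text \<open>The form in which this is applied: \<open>x\<close> and \<open>y\<close> are the two
  ends of their chain, so a swap at \<open>z\<close> changes nothing at either.\<close>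

lemma vcomp_other_end:
  assumes "proper \<phi>" "a \<in> {1..k}" "b \<in> {1..k}" "a \<noteq> b"
    and "miss \<phi> a x \<or> miss \<phi> b x" "miss \<phi> a y \<or> miss \<phi> b y" "miss \<phi> a z \<or> miss \<phi> b z"
    and "x \<noteq> y" "x \<noteq> z" "y \<noteq> z" "y \<in> vcomp \<phi> a b x"
  shows "x \<notin> vcomp \<phi> a b z" "y \<notin> vcomp \<phi> a b z"
  using vcomp_two_ends[OF assms] assms(11) vcomp_sym vcomp_trans by metis+

end

text \<open>\<open>R\<close> stands for reachability from one colouring by Kempe changes. It enters
  through properties shared by all reachable colourings, so each result holds for all of them at
  once; \<open>R_no_common\<close> is the failure of statement (1).\<close>

locale kempe_class = multigraph V E ends k
  for V :: "'v set" and E :: "'e set" and ends k +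
  fixes e0 :: 'e and R :: "('e \<Rightarrow> nat option) \<Rightarrow> bool"
  assumes e0: "e0 \<in> E"
    and kge: "max_degree V E ends + 1 \<le> k"
    and R_proper: "R \<phi> \<Longrightarrow> proper \<phi>"
    and R_e0: "R \<phi> \<Longrightarrow> \<phi> e0 = None"
    and R_kswap: "R \<phi> \<Longrightarrow> a \<in> {1..k} \<Longrightarrow> b \<in> {1..k} \<Longrightarrow> a \<noteq> b \<Longrightarrow> R (kswap \<phi> a b v)"
    and R_no_common: "R \<phi> \<Longrightarrow> \<exists>x\<in>ends e0. \<not> miss \<phi> c x"
begin

lemma card_missing_ge_1:
  assumes "R \<phi>" "v \<in> V"
  shows "1 \<le> card {c. miss \<phi> c v}"
proof -
  have "card {f\<in>E. v \<in> ends f \<and> \<phi> f \<noteq> None} \<le> degree E ends v"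
    unfolding degree_def by (rule card_mono) (use finite_E in auto)
  thus ?thesis using card_missing_ge[OF R_proper[OF assms(1)], of v] degree_le_max_degree[OF assms(2)] kge
    by linarith
qed

lemma ex_missing:
  assumes "R \<phi>" "v \<in> V"
  obtains c where "miss \<phi> c v"
proof -
  have "{c. miss \<phi> c v} \<noteq> {}" using card_missing_ge_1[OF assms] by (metis card.empty not_one_le_zero)
  thus ?thesis using that by blast
qed

lemma card_missing_ge_2:
  assumes "R \<phi>" "v \<in> ends e0"
  shows "2 \<le> card {c. miss \<phi> c v}"
proof -
  have v: "v \<in> V" using assms(2) ends_subset_V e0 by blast
  have "e0 \<in> {f\<in>E. v \<in> ends f} - {f\<in>E. v \<in> ends f \<and> \<phi> f \<noteq> None}"
    using e0 assms(2) R_e0[OF assms(1)] by simp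
  hence "{f\<in>E. v \<in> ends f \<and> \<phi> f \<noteq> None} \<subset> {f\<in>E. v \<in> ends f}" by blast
  hence "card {f\<in>E. v \<in> ends f \<and> \<phi> f \<noteq> None} < degree E ends v"
    unfolding degree_def by (rule psubset_card_mono[rotated]) (use finite_E in auto)
  thus ?thesis using card_missing_ge[OF R_proper[OF assms(1)], of v] degree_le_max_degree[OF v] kge
    by linarith
qed

text \<open>Only \<open>e j\<close> with \<open>j \<ge> 2\<close> is meaningful: it attaches \<open>y j\<close>. In \<open>tail y e n p\<close> the vertices
  \<open>y p, \<dots>, y n\<close> form a path; since \<open>y 0\<close> and \<open>y 1\<close> are joined by \<open>e0\<close>, the values \<open>p = 0\<close> and
  \<open>p = 1\<close> are equivalent.\<close>

definition tree :: "('e \<Rightarrow> nat option) \<Rightarrow> (nat \<Rightarrow> 'v) \<Rightarrow> (nat \<Rightarrow> 'e) \<Rightarrow> nat \<Rightarrow> bool" where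
  "tree \<phi> y e n \<longleftrightarrow> ends e0 = {y 0, y 1} \<and> inj_on y {..n} \<and>
     (\<forall>j\<in>{2..n}. e j \<in> E \<and> (\<exists>i<j. ends (e j) = {y i, y j}) \<and>
        (\<exists>c. \<phi> (e j) = Some c \<and> (\<exists>i<j. miss \<phi> c (y i))))"

definition tail :: "(nat \<Rightarrow> 'v) \<Rightarrow> (nat \<Rightarrow> 'e) \<Rightarrow> nat \<Rightarrow> nat \<Rightarrow> bool" where
  "tail y e n p \<longleftrightarrow> (\<forall>j\<in>{2..n}. p < j \<longrightarrow> ends (e j) = {y (j - 1), y j})"

abbreviation elem :: "('e \<Rightarrow> nat option) \<Rightarrow> (nat \<Rightarrow> 'v) \<Rightarrow> nat \<Rightarrow> bool" where
  "elem \<phi> y n \<equiv> elementary E ends k \<phi> (y ` {..n})"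

lemma tree_prefix: "tree \<phi> y e n \<Longrightarrow> m \<le> n \<Longrightarrow> tree \<phi> y e m"
  unfolding tree_def by (auto intro: inj_on_subset)

lemma tail_prefix: "tail y e n p \<Longrightarrow> m \<le> n \<Longrightarrow> tail y e m p"
  unfolding tail_def by auto

lemma tree_inj: "tree \<phi> y e n \<Longrightarrow> i \<le> n \<Longrightarrow> j \<le> n \<Longrightarrow> y i = y j \<longleftrightarrow> i = j"
  unfolding tree_def by (auto dest: inj_onD)

lemma tree_edge: "tree \<phi> y e n \<Longrightarrow> j \<in> {2..n} \<Longrightarrow> e j \<in> E"
  unfolding tree_def by blast

lemma tree_parent:
  assumes "tree \<phi> y e n" "j \<in> {2..n}"
  obtains i where "i < j" "ends (e j) = {y i, y j}"
  using assms unfolding tree_def by blast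

lemma tree_colour:
  assumes "tree \<phi> y e n" "j \<in> {2..n}"
  obtains c i where "\<phi> (e j) = Some c" "i < j" "miss \<phi> c (y i)"
  using assms unfolding tree_def by blast

lemma tree_in_V:
  assumes "tree \<phi> y e n" "i \<le> n"
  shows "y i \<in> V"
proof (cases "2 \<le> i")
  case True
  hence "e i \<in> E" "y i \<in> ends (e i)" using assms unfolding tree_def by auto
  thus ?thesis using ends_subset_V by blast
next
  case False
  hence "i = 0 \<or> i = 1" by linarith
  hence "y i \<in> ends e0" using assms unfolding tree_def by auto
  thus ?thesis using ends_subset_V e0 by blast
qed

lemma elemD:
  assumes "elem \<phi> y m" "tree \<phi> y e n" "m \<le> n" "i \<le> m" "j \<le> m" "miss \<phi> c (y i)" "miss \<phi> c (y j)"
  shows "i = j"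
  using elementaryD[OF assms(1), of "y i" "y j" c] assms tree_inj[OF assms(2), of i j] by auto

text \<open>The colour of the \<open>j\<close>-th tree edge is missing at an earlier vertex, and by elementarity
  nowhere else.\<close>

lemma tree_colour_index:
  assumes "tree \<phi> y e n" "elem \<phi> y (n - 1)" "j \<in> {2..n}" "\<phi> (e j) = Some c" "miss \<phi> c (y i)" "i < n"
  shows "i < j"
proof -
  obtain i' where "i' < j" "miss \<phi> c (y i')" using tree_colour[OF assms(1,3)] assms(4) by (metis option.inject)
  moreover have "i \<le> n - 1" "i' \<le> n - 1" using assms(3,6) \<open>i' < j\<close> by auto
  ultimately show ?thesis using elemD[OF assms(2,1), of i i' c] assms(5) by simp
qed

lemma tree_kswap:
  assumes "tree \<phi> y e n"
    and "\<And>j. j \<in> {2..n} \<Longrightarrow> \<phi> (e j) = Some a \<or> \<phi> (e j) = Some b \<Longrightarrow>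
      \<exists>c. kswap \<phi> a b v (e j) = Some c \<and> (\<exists>i<j. miss (kswap \<phi> a b v) c (y i))"
  shows "tree (kswap \<phi> a b v) y e n"
  unfolding tree_def
proof (intro conjI ballI)
  fix j assume j: "j \<in> {2..n}"
  show "\<exists>c. kswap \<phi> a b v (e j) = Some c \<and> (\<exists>i<j. miss (kswap \<phi> a b v) c (y i))"
  proof (cases "\<phi> (e j) = Some a \<or> \<phi> (e j) = Some b")
    case True thus ?thesis using assms(2) j by blast
  next
    case False
    obtain c i where "\<phi> (e j) = Some c" "i < j" "miss \<phi> c (y i)"
      using tree_colour[OF assms(1) j] by blast
    moreover from this have "kswap \<phi> a b v (e j) = Some c" "miss (kswap \<phi> a b v) c (y i)"
      using False by (auto simp: kswap_other miss_kswap_other)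
    ultimately show ?thesis by blast
  qed
qed (use assms(1) in \<open>auto simp: tree_def\<close>)

text \<open>Which edges the chain meets is irrelevant: an edge coloured \<open>a\<close> or
  \<open>b\<close> keeps one of the two colours, and after the swap both are missing at earlier
  vertices.\<close>

lemma kswap_tree_edge:
  assumes "\<phi> f = Some a \<or> \<phi> f = Some b" "i < j" "i' < (j::nat)"
    and "miss (kswap \<phi> a b v) a (y i)" "miss (kswap \<phi> a b v) b (y i')"
  shows "\<exists>c. kswap \<phi> a b v f = Some c \<and> (\<exists>i<j. miss (kswap \<phi> a b v) c (y i))"
  using kswap_ab[of \<phi> f a b v] assms by blast

text \<open>Attaching to a tree the part of a chain in two missing colours that lies before its first
  vertex in the tree, in reverse order.\<close>

lemma tree_extend:
  assumes T: "tree \<phi> y e m" and m: "1 \<le> m" and P: "alt_path E ends \<phi> a b vs es"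
    and t: "0 < t" "t < length vs" "vs ! t \<in> y ` {..m}" and before: "\<forall>s<t. vs ! s \<notin> y ` {..m}"
    and a: "ia \<le> m" "miss \<phi> a (y ia)" and b: "ib \<le> m" "miss \<phi> b (y ib)"
  obtains y' e' where "tree \<phi> y' e' (m + t)" "tail y' e' (m + t) (m + 1)"
    "\<forall>j\<le>m. y' j = y j" "y' (m + t) = vs ! 0"
proof -
  define y' where "y' j = (if j \<le> m then y j else vs ! (t - (j - m)))" for j
  define e' where "e' j = (if j \<le> m then e j else es ! (t - (j - m)))" for j
  have len: "length vs = Suc (length es)" and dist: "distinct vs" using P by (auto simp: alt_path_def)
  have new: "e' j \<in> E \<and> \<phi> (e' j) \<in> {Some a, Some b} \<and>
      ends (e' j) = {vs ! (t - (j - m)), vs ! Suc (t - (j - m))}"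
    if "m < j" "j \<le> m + t" for j
  proof -
    have "t - (j - m) < length es" using that t len by auto
    thus ?thesis using P that unfolding alt_path_def e'_def by auto
  qed
  have inj: "inj_on y' {..m + t}"
  proof (rule inj_onI)
    fix i j assume ij: "i \<in> {..m + t}" "j \<in> {..m + t}" "y' i = y' j"
    have *: "\<not> (i \<le> m \<and> m < j \<and> j \<le> m + t \<and> y' i = y' j)" for i j
    proof
      assume A: "i \<le> m \<and> m < j \<and> j \<le> m + t \<and> y' i = y' j"
      hence "t - (j - m) < t" by linarith
      thus False using before A unfolding y'_def by (metis atMost_iff imageI not_le)
    qed
    consider "i \<le> m" "j \<le> m" | "m < i" "m < j"
      using *[of i j] *[of j i] ij by force
    thus "i = j"
    proof cases
      case 1 thus ?thesis using ij T unfolding y'_def tree_def by (auto dest: inj_onD)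
    next
      case 2
      hence "vs ! (t - (i - m)) = vs ! (t - (j - m))" using ij(3) by (simp add: y'_def)
      hence "t - (i - m) = t - (j - m)"
        using dist t by (subst (asm) nth_eq_iff_index_eq) auto
      thus ?thesis using 2 ij by auto
    qed
  qed
  have "tree \<phi> y' e' (m + t)" unfolding tree_def
  proof (intro conjI ballI)
    show "ends e0 = {y' 0, y' 1}" using T m by (simp add: tree_def y'_def)
    show "inj_on y' {..m + t}" by (rule inj)
    fix j assume j: "j \<in> {2..m + t}"
    show "e' j \<in> E" using new[of j] j T unfolding tree_def e'_def by (cases "j \<le> m") auto
    show "\<exists>i<j. ends (e' j) = {y' i, y' j}"
    proof (cases "j \<le> m")
      case True
      then obtain i where "i < j" "ends (e j) = {y i, y j}" using tree_parent[OF T, of j] j by auto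
      thus ?thesis using True by (intro exI[of _ i]) (auto simp: y'_def e'_def)
    next
      case False
      show ?thesis
      proof (cases "j = Suc m")
        case True
        obtain i where i: "i \<le> m" "vs ! t = y i" using t(3) by auto
        have "ends (e' j) = {vs ! (t - 1), vs ! t}" using new[of j] True j t(1) by auto
        thus ?thesis using True i by (intro exI[of _ i]) (auto simp: y'_def)
      next
        case False
        hence "m < j - 1" "Suc (t - (j - m)) = t - (j - 1 - m)" using \<open>\<not> j \<le> m\<close> j by auto
        thus ?thesis using new[of j] \<open>\<not> j \<le> m\<close> j by (intro exI[of _ "j - 1"]) (auto simp: y'_def)
      qed
    qed
    show "\<exists>c. \<phi> (e' j) = Some c \<and> (\<exists>i<j. miss \<phi> c (y' i))"
    proof (cases "j \<le> m")
      case True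
      then obtain c i where "\<phi> (e j) = Some c" "i < j" "miss \<phi> c (y i)"
        using tree_colour[OF T, of j] j by auto
      thus ?thesis using True by (auto simp: y'_def e'_def)
    next
      case False
      have "miss \<phi> a (y' ia)" "miss \<phi> b (y' ib)" "ia < j" "ib < j" using a b False by (auto simp: y'_def)
      thus ?thesis using new[of j] j False by auto
    qed
  qed
  moreover have "tail y' e' (m + t) (m + 1)" unfolding tail_def
  proof (intro ballI impI)
    fix j assume j: "j \<in> {2..m + t}" "m + 1 < j"
    hence "m < j - 1" "Suc (t - (j - m)) = t - (j - 1 - m)" by auto
    thus "ends (e' j) = {y' (j - 1), y' j}" using new[of j] j by (auto simp: y'_def)
  qed
  moreover have "y' (m + t) = vs ! 0" using t by (simp add: y'_def)
  ultimately show ?thesis using that by (simp add: y'_def)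
qed

text \<open>Elementarity makes the sets of missing colours disjoint, so their sizes add: two at
  \<open>y 0\<close>, an end of the uncoloured \<open>e0\<close>, and at least one at every further
  vertex.\<close>

lemma card_missing_tree:
  assumes "R \<phi>" "tree \<phi> y e m" "elem \<phi> y m"
  shows "m + 2 \<le> card (\<Union>i\<le>m. {c. miss \<phi> c (y i)})"
  using assms(2,3)
proof (induction m)
  case 0
  have "y 0 \<in> ends e0" using 0 by (simp add: tree_def)
  thus ?case using card_missing_ge_2[OF assms(1), of "y 0"] by simp
next
  case (Suc m)
  have "y ` {..m} \<subseteq> y ` {..Suc m}" by auto
  hence "elem \<phi> y m" using Suc.prems(2) unfolding elementary_def by blast
  hence IH: "m + 2 \<le> card (\<Union>i\<le>m. {c. miss \<phi> c (y i)})"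
    using Suc.IH tree_prefix[OF Suc.prems(1), of m] by simp
  have "card (\<Union>i\<le>Suc m. {c. miss \<phi> c (y i)}) =
      card ((\<Union>i\<le>m. {c. miss \<phi> c (y i)}) \<union> {c. miss \<phi> c (y (Suc m))})"
    by (simp add: atMost_Suc Un_commute)
  also have "\<dots> = card (\<Union>i\<le>m. {c. miss \<phi> c (y i)}) + card {c. miss \<phi> c (y (Suc m))}"
  proof (rule card_Un_disjoint)
    show "(\<Union>i\<le>m. {c. miss \<phi> c (y i)}) \<inter> {c. miss \<phi> c (y (Suc m))} = {}"
    proof (rule ccontr)
      assume "\<not> ?thesis"
      then obtain c i where "i \<le> m" "miss \<phi> c (y i)" "miss \<phi> c (y (Suc m))" by auto
      thus False using elemD[OF Suc.prems(2,1) order_refl, of i "Suc m" c] by simp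
    qed
  qed (auto simp: finite_missing)
  finally show ?case
    using IH card_missing_ge_1[OF assms(1) tree_in_V[OF Suc.prems(1) order_refl]] by linarith
qed

text \<open>There are \<open>m + 1\<close> edges \<open>e 2\<close>, ..., \<open>e p\<close>, but at
  least \<open>m + 2\<close> colours missing on \<open>y 0\<close>, ..., \<open>y m\<close>.\<close>

lemma ex_free_colour:
  assumes "R \<phi>" "tree \<phi> y e n" "elem \<phi> y m" "m + 2 = p" "p \<le> n"
  obtains \<gamma> i where "i \<le> m" "miss \<phi> \<gamma> (y i)" "\<forall>j\<in>{2..p}. \<phi> (e j) \<noteq> Some \<gamma>"
proof -
  let ?M = "\<Union>i\<le>m. {c. miss \<phi> c (y i)}" and ?U = "(\<lambda>j. the (\<phi> (e j))) ` {2..p}"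
  have "card ?U \<le> card {2..p}" by (rule card_image_le) simp
  hence "card ?U < card ?M"
    using card_missing_tree[OF assms(1) tree_prefix[OF assms(2)] assms(3)] assms(4,5) by simp
  hence "\<not> ?M \<subseteq> ?U" by (metis card_mono finite_atLeastAtMost finite_imageI not_le)
  then obtain \<gamma> where g: "\<gamma> \<in> ?M" "\<gamma> \<notin> ?U" by blast
  hence "\<forall>j\<in>{2..p}. \<phi> (e j) \<noteq> Some \<gamma>" by (metis imageI option.sel)
  thus ?thesis using that g by auto
qed

text \<open>The induction hypothesis for the lexicographic induction on \<open>(p, n)\<close>: first the start of the
  path at the end of the tree, then the size of the tree.\<close>

definition below :: "nat \<Rightarrow> nat \<Rightarrow> bool" where
  "below p n \<longleftrightarrow> (\<forall>p' n' \<phi> y e. p' < p \<or> p' = p \<and> n' < n \<longrightarrow> R \<phi> \<longrightarrow> tree \<phi> y e n' \<longrightarrow>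
     tail y e n' p' \<longrightarrow> elem \<phi> y n')"

section \<open>Moving a conflict in a minimal counterexample\<close>

lemma belowD:
  assumes "below p n" "p' < p \<or> p' = p \<and> n' < n" "R \<phi>" "tree \<phi> y e n'" "tail y e n' p'"
  shows "elem \<phi> y n'"
  using assms unfolding below_def by blast

lemma below_prefix:
  assumes "below p n" "R \<phi>" "tree \<phi> y e n" "tail y e n p" "m < n"
  shows "elem \<phi> y m"
  using belowD[OF assms(1) _ assms(2) tree_prefix[OF assms(3)] tail_prefix[OF assms(4)], of m] assms(5)
  by simp

lemma chain_between:
  assumes B: "below p n" and R: "R \<phi>" and T: "tree \<phi> y e n" and tl: "tail y e n p"
    and im: "i < m" "m < n" and g: "miss \<phi> \<gamma> (y i)" and d: "miss \<phi> \<delta> (y m)"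
    and unused: "\<forall>j\<in>{2..m}. \<phi> (e j) \<noteq> Some \<gamma>"
  shows "\<gamma> \<noteq> \<delta>" "y i \<in> vcomp \<phi> \<gamma> \<delta> (y m)"
proof -
  have el: "elem \<phi> y m" using below_prefix[OF B R T tl im(2)] .
  show ne: "\<gamma> \<noteq> \<delta>" using elemD[OF el T, of i m] im g d by auto
  have r: "\<gamma> \<in> {1..k}" "\<delta> \<in> {1..k}" using g d miss_range by blast+
  show "y i \<in> vcomp \<phi> \<gamma> \<delta> (y m)"
  proof (rule ccontr)
    assume out: "y i \<notin> vcomp \<phi> \<gamma> \<delta> (y m)"
    let ?\<phi> = "kswap \<phi> \<gamma> \<delta> (y m)"
    have Tm: "tree \<phi> y e m" using tree_prefix[OF T] im by simp
    have unused': "\<phi> (e j) \<noteq> Some \<delta>" if "j \<in> {2..m}" for j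
    proof
      assume "\<phi> (e j) = Some \<delta>"
      moreover have "\<exists>c. \<phi> (e j) = Some c \<and> (\<exists>i<j. miss \<phi> c (y i))"
        using Tm that unfolding tree_def by blast
      ultimately obtain l where "l < j" "miss \<phi> \<delta> (y l)" by auto
      thus False using elemD[OF el T, of l m] d that im by auto
    qed
    have "tree ?\<phi> y e m" using tree_kswap[OF Tm] unused unused' by blast
    hence "elem ?\<phi> y m"
      using belowD[OF B _ R_kswap[OF R r ne] _ tail_prefix[OF tl], of m] im by simp
    moreover have "miss ?\<phi> \<gamma> (y i)" using miss_kswap_out[OF out] g by simp
    moreover have "miss ?\<phi> \<gamma> (y m)" using miss_kswap_in[OF vcomp_self r] d by simp
    ultimately have "y i = y m" using elementaryD[of ?\<phi> "y ` {..m}" "y i" "y m" \<gamma>] im by auto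
    thus False using tree_inj[OF T, of i m] im by simp
  qed
qed

lemma conflict_on_tail:
  assumes B: "below p n" and R: "R \<phi>" and T: "tree \<phi> y e n" and tl: "tail y e n p"
    and r: "p \<le> r" "r < n" and a: "miss \<phi> \<alpha> (y r)" "miss \<phi> \<alpha> (y n)"
  shows False
  using R T r a
proof (induction "n - r" arbitrary: \<phi> \<alpha> r rule: less_induct)
  case less
  note R = less.prems(1) and T = less.prems(2) and r = less.prems(3,4) and a = less.prems(5,6)
  have P: "proper \<phi>" using R_proper[OF R] .
  have el: "elem \<phi> y (n - 1)" using below_prefix[OF B R T tl, of "n - 1"] r by simp
  have ra: "\<alpha> \<in> {1..k}" using a miss_range by blast
  show False
  proof (cases "Suc r = n")
    case True
    show False
    proof (cases "n = 1")
      \<comment> \<open>Now \<open>y r\<close> and \<open>y n\<close> are the two ends of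
        \<open>e0\<close>; this is where the failure of (1) enters.\<close>
      case True
      hence "\<forall>x\<in>ends e0. miss \<phi> \<alpha> x" using a T \<open>Suc r = n\<close> by (auto simp: tree_def)
      thus False using R_no_common[OF R] by blast
    next
      case False
      hence n2: "n \<in> {2..n}" using r by auto
      have en: "e n \<in> E" "ends (e n) = {y r, y n}"
        using T tl n2 r True unfolding tree_def tail_def by auto
      obtain \<gamma> i where g: "\<phi> (e n) = Some \<gamma>" "i < n" "miss \<phi> \<gamma> (y i)"
        using tree_colour[OF T n2] by blast
      have ir: "i \<noteq> r" using missD[OF g(3) en(1)] g(1) en(2) by auto
      have ne: "\<alpha> \<noteq> \<gamma>" using missD[OF a(1) en(1)] g(1) en(2) by auto
      have rg: "\<gamma> \<in> {1..k}" using g miss_range by blast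
      \<comment> \<open>Both ends of \<open>e n\<close> miss \<alpha>, so the chain is this edge
        alone and the swap recolours it. That frees \<gamma> at \<open>y r = y (n - 1)\<close>, in
        conflict with \<open>y i\<close> in the tree without \<open>y n\<close>.\<close>
      let ?\<phi> = "kswap \<phi> \<alpha> \<gamma> (y n)"
      have only: "f = e n" if "f \<in> ab_edges E \<phi> \<alpha> \<gamma>" "x \<in> ends f" "x \<in> {y r, y n}" for f x
      proof -
        have "f \<in> E" "\<phi> f = Some \<gamma>" using that a missD unfolding ab_edges_def by auto
        thus ?thesis using proper_unique[OF P _ en(1) that(2)] that(3) en(2) g(1) by auto
      qed
      have sub: "vcomp \<phi> \<alpha> \<gamma> (y n) \<subseteq> {y r, y n}"
      proof (rule vcomp_subset)
        fix f x z assume "f \<in> ab_edges E \<phi> \<alpha> \<gamma>" "x \<in> ends f" "x \<in> {y r, y n}" "z \<in> ends f"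
        thus "z \<in> {y r, y n}" using only[of f x] en(2) by blast
      qed simp
      have yr: "y r \<in> vcomp \<phi> \<alpha> \<gamma> (y n)"
        using vcomp_closed[OF _ _ vcomp_self, of "e n" \<phi> \<alpha> \<gamma> "y n" "y r"] en g by (auto simp: ab_edges_def)
      have yi: "y i \<notin> vcomp \<phi> \<alpha> \<gamma> (y n)" using sub tree_inj[OF T] ir g(2) r by fastforce
      have mi: "miss ?\<phi> \<gamma> (y i)" using miss_kswap_out[OF yi] g by simp
      have Tn: "tree \<phi> y e (n - 1)" using tree_prefix[OF T] by simp
      have "tree ?\<phi> y e (n - 1)"
      proof (rule tree_kswap[OF Tn])
        fix j assume j: "j \<in> {2..n - 1}" and c: "\<phi> (e j) = Some \<alpha> \<or> \<phi> (e j) = Some \<gamma>"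
        have jn: "j \<in> {2..n}" using j by auto
        have "\<phi> (e j) \<noteq> Some \<alpha>" using tree_colour_index[OF T el jn _ a(1)] r j True by auto
        hence c: "\<phi> (e j) = Some \<gamma>" using c by simp
        have "i < j" using tree_colour_index[OF T el jn c g(3,2)] .
        obtain l where l: "l < j" "ends (e j) = {y l, y j}" using tree_parent[OF T jn] by blast
        have "y n \<notin> ends (e j)" using l j tree_inj[OF T] by auto
        hence "e j \<noteq> e n" using en by auto
        hence "y j \<notin> {y r, y n}" using only[of "e j" "y j"] l tree_edge[OF T jn] c
          by (auto simp: ab_edges_def)
        hence "y j \<notin> vcomp \<phi> \<alpha> \<gamma> (y n)" using sub by blast
        hence "?\<phi> (e j) = Some \<gamma>" using kswap_out[of "y j" "e j"] l(2) c by simp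
        thus "\<exists>c. ?\<phi> (e j) = Some c \<and> (\<exists>i<j. miss ?\<phi> c (y i))" using \<open>i < j\<close> mi by blast
      qed
      hence "elem ?\<phi> y (n - 1)"
        using belowD[OF B _ R_kswap[OF R ra rg ne] _ tail_prefix[OF tl], of "n - 1"] r by simp
      moreover have "miss ?\<phi> \<gamma> (y r)" using miss_kswap_in[OF yr ra rg] a by simp
      ultimately have "y i = y r"
        using elementaryD[of ?\<phi> "y ` {..n - 1}" "y i" "y r" \<gamma>] mi g(2) r by auto
      thus False using tree_inj[OF T] ir g(2) r by simp
    qed
  next
    case False
    hence rn: "Suc r < n" using r by simp
    obtain \<beta> where b: "miss \<phi> \<beta> (y (Suc r))"
      using ex_missing[OF R tree_in_V[OF T]] rn by (metis less_imp_le)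
    have rb: "\<beta> \<in> {1..k}" using b miss_range by blast
    \<comment> \<open>\<open>e (Suc r)\<close> lies on the tail and ends at \<open>y r\<close>,
      which misses \<alpha>; on earlier edges \<alpha> cannot occur, since by elementarity it is
      missing at no vertex before \<open>y r\<close>.\<close>
    have unused: "\<forall>j\<in>{2..Suc r}. \<phi> (e j) \<noteq> Some \<alpha>"
    proof
      fix j assume j: "j \<in> {2..Suc r}"
      show "\<phi> (e j) \<noteq> Some \<alpha>"
      proof (cases "j = Suc r")
        case True
        hence "e j \<in> E" "y r \<in> ends (e j)" using T tl j rn r unfolding tree_def tail_def by auto
        thus ?thesis using missD[OF a(1)] by blast
      next
        case False
        thus ?thesis using tree_colour_index[OF T el _ _ a(1)] r j by fastforce
      qed
    qed
    note ch = chain_between[OF B R T tl lessI rn a(1) b unused]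
    have dist: "y (Suc r) \<noteq> y r" "y (Suc r) \<noteq> y n" "y r \<noteq> y n" using tree_inj[OF T] r rn by auto
    note out = vcomp_other_end[OF P ra rb ch(1) disjI2[OF b] disjI1[OF a(1)] disjI1[OF a(2)] dist ch(2)]
    \<comment> \<open>The chain joining \<open>y r\<close> and \<open>y (Suc r)\<close> has no third
      end, so \<open>y n\<close> trades \<alpha> for \<beta> without disturbing them and the
      conflict is now with \<open>y (Suc r)\<close>.\<close>
    let ?\<phi> = "kswap \<phi> \<alpha> \<beta> (y n)"
    have ma: "miss ?\<phi> \<alpha> (y r)" using miss_kswap_out[OF out(2)] a by simp
    have mb: "miss ?\<phi> \<beta> (y (Suc r))" using miss_kswap_out[OF out(1)] b by simp
    have mn: "miss ?\<phi> \<beta> (y n)" using miss_kswap_in[OF vcomp_self ra rb] a by simp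
    have "tree ?\<phi> y e n"
    proof (rule tree_kswap[OF T])
      fix j assume j: "j \<in> {2..n}" and c: "\<phi> (e j) = Some \<alpha> \<or> \<phi> (e j) = Some \<beta>"
      have "Suc r < j"
        using c unused j tree_colour_index[OF T el j _ b] rn by (cases "Suc r < j") auto
      thus "\<exists>c. ?\<phi> (e j) = Some c \<and> (\<exists>i<j. miss ?\<phi> c (y i))"
        using kswap_tree_edge[OF c _ _ ma mb] by auto
    qed
    moreover have "n - Suc r < n - r" "p \<le> Suc r" using r by auto
    ultimately show False using less.hyps R_kswap[OF R ra rb ch(1)] mb mn rn by blast
  qed
qed

text \<open>If \<open>p\<close> is the least start of a tail, then \<open>e p\<close> is attached to some \<open>y q\<close> with \<open>q \<le> p - 2 = m\<close>,
  hence every tree edge up to \<open>e p\<close> meets \<open>{y 0, \<dots>, y m}\<close>. A chain from \<open>y n\<close> in two colours missing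
  there either avoids this set, so that swapping it leaves those edges alone, or yields a tree
  whose tail starts before \<open>p\<close>.\<close>

lemma conflict_made_free:
  assumes B: "below p n" and R: "R \<phi>" and T: "tree \<phi> y e n" and tl: "tail y e n p"
    and p: "p = m + 2" "1 \<le> m" "p \<le> n" and q: "q \<le> m" "ends (e p) = {y q, y p}"
    and r: "r \<le> m" and a: "miss \<phi> \<alpha> (y r)" "miss \<phi> \<alpha> (y n)"
  obtains \<phi>' \<gamma> i where "R \<phi>'" "tree \<phi>' y e n" "i \<le> m" "miss \<phi>' \<gamma> (y i)" "miss \<phi>' \<gamma> (y n)"
    "\<forall>j\<in>{2..p}. \<phi>' (e j) \<noteq> Some \<gamma>"
proof -
  have P: "proper \<phi>" using R_proper[OF R] .
  have el: "elem \<phi> y (n - 1)" using below_prefix[OF B R T tl, of "n - 1"] p by simp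
  have elm: "elem \<phi> y m" using below_prefix[OF B R T tl, of m] p by simp
  have ra: "\<alpha> \<in> {1..k}" using a miss_range by blast
  obtain \<gamma> i where g: "i \<le> m" "miss \<phi> \<gamma> (y i)" "\<forall>j\<in>{2..p}. \<phi> (e j) \<noteq> Some \<gamma>"
    using ex_free_colour[OF R T elm] p by metis
  have rg: "\<gamma> \<in> {1..k}" using g miss_range by blast
  show ?thesis
  proof (cases "\<alpha> = \<gamma>")
    case True
    thus ?thesis using that R T g a by blast
  next
    case ne: False
    obtain vs es where C: "alt_path E ends \<phi> \<alpha> \<gamma> vs es" "vs ! 0 = y n" "vcomp \<phi> \<alpha> \<gamma> (y n) = set vs"
      using vcomp_chain[OF P ra rg] a by blast
    show ?thesis
    proof (cases "set vs \<inter> y ` {..m} = {}")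
      case False
      define t where "t = (LEAST t. t < length vs \<and> vs ! t \<in> y ` {..m})"
      obtain t0 where t0: "t0 < length vs \<and> vs ! t0 \<in> y ` {..m}"
        using False by (metis disjoint_iff in_set_conv_nth)
      have t: "t < length vs" "vs ! t \<in> y ` {..m}"
        using LeastI[of "\<lambda>t. t < length vs \<and> vs ! t \<in> y ` {..m}", OF t0] by (auto simp: t_def)
      have before: "\<forall>s<t. vs ! s \<notin> y ` {..m}"
        using not_less_Least[of _ "\<lambda>t. t < length vs \<and> vs ! t \<in> y ` {..m}"] t(1)
        unfolding t_def by (metis (no_types, lifting) less_trans)
      have "y n \<notin> y ` {..m}" using tree_inj[OF T] p by fastforce
      hence t0: "0 < t" using C(2) t(2) by (cases t) auto
      obtain y' e' where T': "tree \<phi> y' e' (m + t)" "tail y' e' (m + t) (m + 1)"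
        "\<forall>j\<le>m. y' j = y j" "y' (m + t) = vs ! 0"
        using tree_extend[OF tree_prefix[OF T] p(2) C(1) t0 t before r a(1) g(1,2)] p by auto
      \<comment> \<open>The new tail starts at \<open>m + 1 < p\<close>, so the induction hypothesis
        applies however many vertices the chain has added.\<close>
      have "elem \<phi> y' (m + t)" using belowD[OF B _ R T'(1,2)] p by simp
      hence "r = m + t" using elemD[OF _ T'(1), of "m + t" r "m + t" \<alpha>] a r T' C(2) by simp
      thus ?thesis using r t0 by simp
    next
      case True
      hence out: "y j \<notin> vcomp \<phi> \<alpha> \<gamma> (y n)" if "j \<le> m" for j using C(3) that by auto
      let ?\<phi> = "kswap \<phi> \<alpha> \<gamma> (y n)"
      have ma: "miss ?\<phi> \<alpha> (y r)" using miss_kswap_out[OF out[OF r]] a by simp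
      have mg: "miss ?\<phi> \<gamma> (y i)" using miss_kswap_out[OF out[OF g(1)]] g by simp
      have mn: "miss ?\<phi> \<gamma> (y n)" using miss_kswap_in[OF vcomp_self ra rg] a by simp
      have same: "?\<phi> (e j) = \<phi> (e j)" if j: "j \<in> {2..p}" for j
      proof -
        have "\<exists>l\<le>m. y l \<in> ends (e j)"
        proof (cases "j = p")
          case True thus ?thesis using q by auto
        next
          case False
          obtain l where "l < j" "ends (e j) = {y l, y j}" using tree_parent[OF T, of j] j p by auto
          thus ?thesis using False j p by (intro exI[of _ l]) auto
        qed
        thus ?thesis using kswap_out out by blast
      qed
      have "tree ?\<phi> y e n"
      proof (rule tree_kswap[OF T])
        fix j assume j: "j \<in> {2..n}" and c: "\<phi> (e j) = Some \<alpha> \<or> \<phi> (e j) = Some \<gamma>"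
        show "\<exists>c. ?\<phi> (e j) = Some c \<and> (\<exists>i<j. miss ?\<phi> c (y i))"
        proof (cases "j \<le> p")
          case True
          hence "\<phi> (e j) = Some \<alpha>" using c g(3) j by auto
          moreover from this have "r < j" using tree_colour_index[OF T el j _ a(1)] r p by simp
          ultimately show ?thesis using same[of j] True j ma by auto
        next
          case False
          thus ?thesis using kswap_tree_edge[OF c _ _ ma mg] r g(1) p by simp
        qed
      qed
      thus ?thesis using that[OF R_kswap[OF R ra rg ne] _ g(1) mg mn] same g(3) by simp
    qed
  qed
qed

text \<open>\<open>y i\<close> and \<open>y (m + 1)\<close> are the ends of one chain, so
  \<open>y n\<close> can trade \<alpha> for \<gamma>. The swapped colouring is named in the
  conclusion, not hidden, because the colour of the last tree edge has to be followed through the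
  swap.\<close>

lemma conflict_moved_down:
  assumes B: "below p n" and R: "R \<phi>" and T: "tree \<phi> y e n" and tl: "tail y e n p"
    and p: "p = m + 2" "1 \<le> m" "p \<le> n"
    and a: "miss \<phi> \<alpha> (y (m + 1))" "miss \<phi> \<alpha> (y n)"
  obtains \<gamma> i where "\<gamma> \<noteq> \<alpha>" "R (kswap \<phi> \<gamma> \<alpha> (y n))" "tree (kswap \<phi> \<gamma> \<alpha> (y n)) y e n" "i \<le> m"
    "miss (kswap \<phi> \<gamma> \<alpha> (y n)) \<gamma> (y i)" "miss (kswap \<phi> \<gamma> \<alpha> (y n)) \<gamma> (y n)"
    "\<forall>j\<in>{2..p}. \<phi> (e j) \<noteq> Some \<gamma>"
proof -
  have P: "proper \<phi>" using R_proper[OF R] .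
  have el: "elem \<phi> y (n - 1)" using below_prefix[OF B R T tl, of "n - 1"] p by simp
  have elm: "elem \<phi> y m" using below_prefix[OF B R T tl, of m] p by simp
  have ra: "\<alpha> \<in> {1..k}" using a miss_range by blast
  obtain \<gamma> i where g: "i \<le> m" "miss \<phi> \<gamma> (y i)" "\<forall>j\<in>{2..p}. \<phi> (e j) \<noteq> Some \<gamma>"
    using ex_free_colour[OF R T elm] p by metis
  have rg: "\<gamma> \<in> {1..k}" using g miss_range by blast
  have "i < m + 1" "m + 1 < n" "\<forall>j\<in>{2..m + 1}. \<phi> (e j) \<noteq> Some \<gamma>" using g p by auto
  note ch = chain_between[OF B R T tl this(1,2) g(2) a(1) this(3)]
  have dist: "y (m + 1) \<noteq> y i" "y (m + 1) \<noteq> y n" "y i \<noteq> y n" using tree_inj[OF T] g(1) p by auto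
  note out = vcomp_other_end[OF P rg ra ch(1) disjI2[OF a(1)] disjI1[OF g(2)] disjI2[OF a(2)] dist ch(2)]
  let ?\<phi> = "kswap \<phi> \<gamma> \<alpha> (y n)"
  have ma: "miss ?\<phi> \<alpha> (y (m + 1))" using miss_kswap_out[OF out(1)] a by simp
  have mg: "miss ?\<phi> \<gamma> (y i)" using miss_kswap_out[OF out(2)] g by simp
  have mn: "miss ?\<phi> \<gamma> (y n)" using miss_kswap_in[OF vcomp_self rg ra] a by simp
  have "tree ?\<phi> y e n"
  proof (rule tree_kswap[OF T])
    fix j assume j: "j \<in> {2..n}" and c: "\<phi> (e j) = Some \<gamma> \<or> \<phi> (e j) = Some \<alpha>"
    have "m + 1 < j"
      using c g(3) j p tree_colour_index[OF T el j _ a(1)] by (cases "m + 1 < j") auto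
    thus "\<exists>c. ?\<phi> (e j) = Some c \<and> (\<exists>i<j. miss ?\<phi> c (y i))"
      using kswap_tree_edge[OF c _ _ mg ma] g(1) by auto
  qed
  thus ?thesis using that[OF ch(1) R_kswap[OF R rg ra ch(1)] _ g(1) mg mn g(3)] by blast
qed

text \<open>Here \<open>p = n\<close>, and \<open>y (n - 1)\<close> can be left out of the tree.\<close>

lemma conflict_drop:
  assumes B: "below n n" and R: "R \<phi>" and T: "tree \<phi> y e n"
    and n: "n = m + 2" "1 \<le> m" and q: "q \<le> m" "ends (e n) = {y q, y n}"
    and c: "\<phi> (e n) = Some c" "l \<le> m" "miss \<phi> c (y l)"
    and r: "r \<le> m" and a: "miss \<phi> \<alpha> (y r)" "miss \<phi> \<alpha> (y n)"
  shows False
proof -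
  define y' where "y' j = (if j \<le> m then y j else y n)" for j
  define e' where "e' j = (if j \<le> m then e j else e n)" for j
  have "tree \<phi> y' e' (m + 1)" unfolding tree_def
  proof (intro conjI ballI)
    show "ends e0 = {y' 0, y' 1}" using T n by (simp add: tree_def y'_def)
    show "inj_on y' {..m + 1}"
    proof (rule inj_onI)
      fix i j assume "i \<in> {..m + 1}" "j \<in> {..m + 1}" "y' i = y' j"
      thus "i = j" using tree_inj[OF T] n unfolding y'_def by (auto split: if_splits)
    qed
    fix j assume j: "j \<in> {2..m + 1}"
    show "e' j \<in> E" using tree_edge[OF T, of j] tree_edge[OF T, of n] j n by (simp add: e'_def)
    show "\<exists>i<j. ends (e' j) = {y' i, y' j}"
    proof (cases "j \<le> m")
      case True
      then obtain i where "i < j" "ends (e j) = {y i, y j}" using tree_parent[OF T, of j] j n by auto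
      thus ?thesis using True by (intro exI[of _ i]) (auto simp: y'_def e'_def)
    next
      case False
      thus ?thesis using q j by (intro exI[of _ q]) (auto simp: y'_def e'_def)
    qed
    show "\<exists>c. \<phi> (e' j) = Some c \<and> (\<exists>i<j. miss \<phi> c (y' i))"
    proof (cases "j \<le> m")
      case True
      then obtain c i where "\<phi> (e j) = Some c" "i < j" "miss \<phi> c (y i)"
        using tree_colour[OF T, of j] j n by auto
      thus ?thesis using True by (auto simp: y'_def e'_def)
    next
      case False
      hence "l < j" "miss \<phi> c (y' l)" using c by (auto simp: y'_def)
      thus ?thesis using c(1) False unfolding e'_def by auto
    qed
  qed
  \<comment> \<open>A tail starting at the last index is no condition, and \<open>m + 1 < n\<close>
    puts the new tree below the bound.\<close>
  moreover from this have "elem \<phi> y' (m + 1)"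
    using belowD[OF B _ R, of "m + 1" "m + 1"] n by (simp add: tail_def)
  ultimately have "r = m + 1"
    using elemD[of \<phi> y' "m + 1" e' "m + 1" r "m + 1" \<alpha>] a r by (simp add: y'_def)
  thus False using r by simp
qed

text \<open>A conflict with \<open>y r\<close> for \<open>r \<ge> p\<close> lies on the tail, and
  one with \<open>y (p - 1)\<close> can be moved down, so the work is in \<open>low\<close>, for
  \<open>r \<le> p - 2\<close>.\<close>

lemma no_conflict:
  assumes B: "below p n" and R: "R \<phi>" and T: "tree \<phi> y e n" and tl: "tail y e n p"
    and r: "r < n" and a: "miss \<phi> \<alpha> (y r)" "miss \<phi> \<alpha> (y n)" and pn: "p \<le> n"
    and p3: "3 \<le> p" and q: "q + 2 \<le> p" "ends (e p) = {y q, y p}"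
  shows False
proof -
  define m where "m = p - 2"
  have p: "p = m + 2" "1 \<le> m" "p \<le> n" and qm: "q \<le> m" using p3 q pn by (auto simp: m_def)
  have low: False if R: "R \<phi>" and T: "tree \<phi> y e n" and rm: "r \<le> m"
    and a: "miss \<phi> \<alpha> (y r)" "miss \<phi> \<alpha> (y n)" for \<phi> r \<alpha>
  proof -
    obtain \<phi>' \<gamma> i where R': "R \<phi>'" and T': "tree \<phi>' y e n" and i: "i \<le> m"
      and g: "miss \<phi>' \<gamma> (y i)" "miss \<phi>' \<gamma> (y n)" and un: "\<forall>j\<in>{2..p}. \<phi>' (e j) \<noteq> Some \<gamma>"
      by (rule conflict_made_free[OF B R T tl p qm q(2) rm a])
    have P: "proper \<phi>'" using R_proper[OF R'] .
    have el: "elem \<phi>' y (n - 1)" using below_prefix[OF B R' T' tl, of "n - 1"] p by simp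
    have rg: "\<gamma> \<in> {1..k}" using g miss_range by blast
    show False
    proof (cases "p = n")
      case False
      obtain \<beta> where b: "miss \<phi>' \<beta> (y p)" using ex_missing[OF R' tree_in_V[OF T' pn]] by blast
      have rb: "\<beta> \<in> {1..k}" using b miss_range by blast
      have ip: "i < p" "p < n" using i p False by auto
      note ch = chain_between[OF B R' T' tl ip g(1) b un]
      have dist: "y p \<noteq> y i" "y p \<noteq> y n" "y i \<noteq> y n" using tree_inj[OF T'] ip by auto
      note out = vcomp_other_end[OF P rg rb ch(1) disjI2[OF b] disjI1[OF g(1)] disjI1[OF g(2)] dist ch(2)]
      let ?\<phi> = "kswap \<phi>' \<gamma> \<beta> (y n)"
      have mg: "miss ?\<phi> \<gamma> (y i)" using miss_kswap_out[OF out(2)] g by simp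
      have mb: "miss ?\<phi> \<beta> (y p)" using miss_kswap_out[OF out(1)] b by simp
      have mn: "miss ?\<phi> \<beta> (y n)" using miss_kswap_in[OF vcomp_self rg rb] g by simp
      have "tree ?\<phi> y e n"
      proof (rule tree_kswap[OF T'])
        fix j assume j: "j \<in> {2..n}" and c: "\<phi>' (e j) = Some \<gamma> \<or> \<phi>' (e j) = Some \<beta>"
        have "p < j" using c un j tree_colour_index[OF T' el j _ b ip(2)] by (cases "p < j") auto
        thus "\<exists>c. ?\<phi> (e j) = Some c \<and> (\<exists>i<j. miss ?\<phi> c (y i))"
          using kswap_tree_edge[OF c _ _ mg mb] ip by auto
      qed
      thus False
        using conflict_on_tail[OF B R_kswap[OF R' rg rb ch(1)] _ tl order_refl ip(2) mb mn] by blast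
    next
      case True
      have B': "below n n" and n: "n = m + 2" and qn: "ends (e n) = {y q, y n}"
        using B True p q by auto
      have n2: "n \<in> {2..n}" using n by simp
      obtain c l where c: "\<phi>' (e n) = Some c" "l < n" "miss \<phi>' c (y l)"
        using tree_colour[OF T' n2] by blast
      show False
      proof (cases "l \<le> m")
        case True
        show False using conflict_drop[OF B' R' T' n p(2) qm qn c(1) True c(3) i g] .
      next
        case False
        hence l: "l = m + 1" using c n by simp
        have rc: "c \<in> {1..k}" using c miss_range by blast
        have "i < m + 1" "m + 1 < n" "\<forall>j\<in>{2..m + 1}. \<phi>' (e j) \<noteq> Some \<gamma>" using i un p n by auto
        note ch = chain_between[OF B R' T' tl this(1,2) g(1) c(3)[unfolded l] this(3)]
        have dist: "y (m + 1) \<noteq> y i" "y (m + 1) \<noteq> y n" "y i \<noteq> y n" using tree_inj[OF T'] i n by auto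
        note out = vcomp_other_end[OF P rg rc ch(1) disjI2[OF c(3)[unfolded l]] disjI1[OF g(1)]
            disjI1[OF g(2)] dist ch(2)]
        \<comment> \<open>\<open>y (n - 1)\<close> cannot be dropped yet, since it is the vertex
          missing the colour \<open>c\<close> of \<open>e n\<close>. The swap gives
          \<open>e n\<close> the colour \<gamma>, missing at \<open>y i\<close> with
          \<open>i \<le> m\<close>, at the price of a conflict with \<open>y (n - 1)\<close> in
          \<open>c\<close>; moving that one down does not touch \<open>e n\<close>.\<close>
        let ?\<phi> = "kswap \<phi>' \<gamma> c (y n)"
        have mg: "miss ?\<phi> \<gamma> (y i)" using miss_kswap_out[OF out(2)] g by simp
        have mc: "miss ?\<phi> c (y (m + 1))" using miss_kswap_out[OF out(1)] c(3) l by simp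
        have mn: "miss ?\<phi> c (y n)" using miss_kswap_in[OF vcomp_self rg rc] g by simp
        have R'': "R ?\<phi>" using R_kswap[OF R' rg rc ch(1)] .
        have T'': "tree ?\<phi> y e n"
        proof (rule tree_kswap[OF T'])
          fix j assume j: "j \<in> {2..n}" and cc: "\<phi>' (e j) = Some \<gamma> \<or> \<phi>' (e j) = Some c"
          have "m + 1 < j"
            using cc un j True tree_colour_index[OF T' el j _ c(3,2)] l by auto
          thus "\<exists>c. ?\<phi> (e j) = Some c \<and> (\<exists>i<j. miss ?\<phi> c (y i))"
            using kswap_tree_edge[OF cc _ _ mg mc] i by auto
        qed
        have en: "?\<phi> (e n) = Some \<gamma>"
          using kswap_in[OF tree_edge[OF T' n2] _ vcomp_self, of "y n" \<phi>' \<gamma> c] qn c(1) ch(1) by auto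
        obtain \<delta> i' where d: "\<delta> \<noteq> c" "R (kswap ?\<phi> \<delta> c (y n))" "tree (kswap ?\<phi> \<delta> c (y n)) y e n"
          "i' \<le> m" "miss (kswap ?\<phi> \<delta> c (y n)) \<delta> (y i')" "miss (kswap ?\<phi> \<delta> c (y n)) \<delta> (y n)"
          "\<forall>j\<in>{2..p}. ?\<phi> (e j) \<noteq> Some \<delta>"
          by (rule conflict_moved_down[OF B R'' T'' tl p mc mn])
        have "\<gamma> \<noteq> \<delta>" using d(7) en n2 True by auto
        hence "kswap ?\<phi> \<delta> c (y n) (e n) = Some \<gamma>" "miss (kswap ?\<phi> \<delta> c (y n)) \<gamma> (y i)"
          using en ch(1) mg by (simp_all add: kswap_other miss_kswap_other)
        thus False using conflict_drop[OF B' d(2,3) n p(2) qm qn _ i _ d(4,5,6)] by blast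
      qed
    qed
  qed
  show False
  proof -
    consider "p \<le> r" | "r = m + 1" | "r \<le> m" using p by linarith
    thus False
    proof cases
      case 1 thus False using conflict_on_tail[OF B R T tl _ r a] by blast
    next
      case 2
      show False by (rule conflict_moved_down[OF B R T tl p a(1)[unfolded 2] a(2)]) (rule low)
    next
      case 3 thus False using low[OF R T _ a] by blast
    qed
  qed
qed

text \<open>\<open>e 2\<close> hangs at \<open>y 0\<close>, so only the numbering of the ends of
  \<open>e0\<close> breaks the path at 2: with the two exchanged, it continues through
  \<open>e0\<close> down to 0.\<close>

lemma tree_flip:
  assumes T: "tree \<phi> y e n" and q: "2 \<le> n" "ends (e 2) = {y 0, y 2}" and tl: "tail y e n 2"
  defines "y' \<equiv> y(0 := y 1, 1 := y 0)"
  shows "tree \<phi> y' e n" "tail y' e n 0" "y' ` {..n} = y ` {..n}"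
proof -
  define s where "s = (\<lambda>j::nat. if j = 0 then 1 else if j = 1 then 0 else j)"
  have y': "y' = y \<circ> s" by (auto simp: y'_def s_def fun_eq_iff)
  have s: "inj s" "s ` {..n} = {..n}" and ss: "\<And>j. s (s j) = j"
    using q(1) by (auto simp: s_def inj_def image_iff Bex_def split: if_splits)
  have sj: "s j = j" if "2 \<le> j" for j using that by (simp add: s_def)
  have sl: "s i < j" if "i < j" "2 \<le> j" for i j using that by (auto simp: s_def)
  show "y' ` {..n} = y ` {..n}" using s(2) by (metis y' image_comp)
  show "tree \<phi> y' e n" unfolding tree_def
  proof (intro conjI ballI)
    show "ends e0 = {y' 0, y' 1}" using T by (auto simp: tree_def y'_def)
    show "inj_on y' {..n}" unfolding y' using T s
      by (intro comp_inj_on) (auto simp: tree_def intro: inj_on_subset)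
    fix j assume j: "j \<in> {2..n}"
    show "e j \<in> E" using tree_edge[OF T j] .
    obtain i where "i < j" "ends (e j) = {y i, y j}" using tree_parent[OF T j] by blast
    thus "\<exists>i<j. ends (e j) = {y' i, y' j}" using sl[of i j] sj[of j] j
      by (intro exI[of _ "s i"]) (simp add: y' ss)
    obtain c i where "\<phi> (e j) = Some c" "i < j" "miss \<phi> c (y i)"
      using tree_colour[OF T j] by blast
    moreover from this have "s i < j" "miss \<phi> c (y' (s i))" using sl j by (auto simp: y' ss)
    ultimately show "\<exists>c. \<phi> (e j) = Some c \<and> (\<exists>i<j. miss \<phi> c (y' i))" by blast
  qed
  show "tail y' e n 0" unfolding tail_def
  proof (intro ballI impI)
    fix j assume j: "j \<in> {2..n}"
    show "ends (e j) = {y' (j - 1), y' j}"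
    proof (cases "j = 2")
      case True thus ?thesis using q by (simp add: y'_def)
    next
      case False
      hence "ends (e j) = {y (j - 1), y j}" "j - 1 \<noteq> 0" "j - 1 \<noteq> 1" "j \<noteq> 0" "j \<noteq> 1"
        using tl j unfolding tail_def by auto
      thus ?thesis unfolding y'_def by simp
    qed
  qed
qed

text \<open>In a counterexample at the minimal pair, \<open>p\<close> is the least tail start of its
  own tree, which for \<open>p \<ge> 2\<close> forces \<open>e p\<close> away from
  \<open>y (p - 1)\<close>. All proper prefixes are elementary, so the conflict involves
  \<open>y n\<close>.\<close>

lemma tree_elementary_aux:
  assumes B: "below p n" and R: "R \<phi>" and T: "tree \<phi> y e n" and tl: "tail y e n p"
  shows "elem \<phi> y n"
proof (rule ccontr)
  assume neg: "\<not> elem \<phi> y n"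
  have shorter: "\<not> tail y e n p'" if "p' < p" for p' using belowD[OF B _ R T] neg that by blast
  have pn: "p \<le> n" using shorter[of n] by (force simp: tail_def)
  obtain i j c where ij: "i \<le> n" "j \<le> n" "y i \<noteq> y j" "miss \<phi> c (y i)" "miss \<phi> c (y j)"
    using neg unfolding elementary_def by auto
  obtain r \<alpha> where r: "r < n" and a: "miss \<phi> \<alpha> (y r)" "miss \<phi> \<alpha> (y n)"
  proof (cases "i = n \<or> j = n")
    case True
    thus ?thesis using ij that[of i c] that[of j c] by (metis le_neq_implies_less)
  next
    case False
    hence "i \<le> n - 1" "j \<le> n - 1" "n - 1 < n" using ij by auto
    moreover from this have "elem \<phi> y (n - 1)" using below_prefix[OF B R T tl] by blast
    ultimately show ?thesis using elementaryD[of \<phi> "y ` {..n - 1}" "y i" "y j" c] ij by auto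
  qed
  show False
  proof (cases "p \<le> r")
    case True thus False using conflict_on_tail[OF B R T tl _ r a] by blast
  next
    case False
    have p2: "2 \<le> p"
    proof (rule ccontr)
      assume "\<not> 2 \<le> p"
      hence "tail y e n 0" using tl by (auto simp: tail_def)
      moreover have "0 < p" using False by simp
      ultimately show False using shorter by blast
    qed
    have "p \<in> {2..n}" using p2 pn by simp
    then obtain q where q: "q < p" "ends (e p) = {y q, y p}" using T unfolding tree_def by blast
    have q2: "q + 2 \<le> p"
    proof (rule ccontr)
      assume "\<not> q + 2 \<le> p"
      hence q1: "q = p - 1" using q by simp
      have "tail y e n (p - 1)" unfolding tail_def
      proof (intro ballI impI)
        fix j assume j: "j \<in> {2..n}" "p - 1 < j"
        show "ends (e j) = {y (j - 1), y j}"
        proof (cases "j = p")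
          case True thus ?thesis using q q1 by simp
        next
          case False thus ?thesis using tl j unfolding tail_def by simp
        qed
      qed
      thus False using shorter[of "p - 1"] p2 by simp
    qed
    show False
    proof (cases "p = 2")
      case True
      hence "2 \<le> n" "ends (e 2) = {y 0, y 2}" "tail y e n 2" using q q2 pn tl by auto
      note fl = tree_flip[OF T this]
      have "0 < p" using True by simp
      hence "elem \<phi> (y(0 := y 1, 1 := y 0)) n" using belowD[OF B _ R fl(1,2)] by blast
      thus False using neg fl(3) by simp
    next
      case False
      thus False using no_conflict[OF B R T tl r a pn _ q2 q(2)] p2 by simp
    qed
  qed
qed

text \<open>Nested inductions realise the lexicographic order. Every tree is covered, because a tail
  starting at \<open>n\<close> is no condition.\<close>

theorem tree_elementary:
  assumes "R \<phi>" "tree \<phi> y e n"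
  shows "elem \<phi> y n"
proof -
  have "\<forall>n. below p n" for p
  proof (induction p rule: less_induct)
    case (less p)
    have "below p n" for n
    proof (induction n rule: less_induct)
      case (less n)
      show ?case unfolding below_def
        using \<open>\<And>p'. p' < p \<Longrightarrow> \<forall>n. below p' n\<close> less.IH tree_elementary_aux by blast
    qed
    thus ?case by blast
  qed
  thus ?thesis using tree_elementary_aux[OF _ assms, of n] by (simp add: tail_def)
qed

end

section \<open>Counting, and the Tashkinov closure\<close>

context multigraph
begin

text \<open>The sets \<open>ends f \<inter> X\<close> over the edges of colour \<open>c\<close> are
  disjoint and cover the vertices of \<open>X\<close> that see \<open>c\<close>; an inner edge
  contributes two, a boundary edge one.\<close>

lemma card_seeing:
  assumes P: "proper \<phi>" and X: "finite X" and c: "c \<in> {1..k}"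
  shows "card {v\<in>X. \<not> miss \<phi> c v} =
    2 * card {f\<in>E. \<phi> f = Some c \<and> ends f \<subseteq> X} + card (boundary_edges E ends \<phi> X c)"
proof -
  let ?A = "{f\<in>E. \<phi> f = Some c}"
  let ?I = "{f\<in>?A. ends f \<subseteq> X}" and ?B = "{f\<in>?A. card (ends f \<inter> X) = 1}"
  have fin: "finite ?A" using finite_E by simp
  have fe: "finite (ends f)" if "f \<in> E" for f using card_ends[OF that] by (simp add: card_ge_0_finite)
  have "{v\<in>X. \<not> miss \<phi> c v} = (\<Union>f\<in>?A. ends f \<inter> X)" using c by (auto simp: missing_def)
  also have "card \<dots> = (\<Sum>f\<in>?A. card (ends f \<inter> X))"
  proof (rule card_UN_disjoint[OF fin])
    show "\<forall>i\<in>?A. \<forall>j\<in>?A. i \<noteq> j \<longrightarrow> (ends i \<inter> X) \<inter> (ends j \<inter> X) = {}"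
      using proper_unique[OF P] by blast
  qed (use X in simp)
  also have "\<dots> = (\<Sum>f\<in>?A. (if ends f \<subseteq> X then 2 else 0) + (if card (ends f \<inter> X) = 1 then 1 else 0))"
  proof (rule sum.cong[OF refl])
    fix f assume f: "f \<in> ?A"
    hence fE: "f \<in> E" by simp
    show "card (ends f \<inter> X) = (if ends f \<subseteq> X then 2 else 0) + (if card (ends f \<inter> X) = 1 then 1 else 0)"
    proof (cases "ends f \<subseteq> X")
      case True
      hence "ends f \<inter> X = ends f" by blast
      thus ?thesis using True card_ends[OF fE] by simp
    next
      case False
      hence "ends f \<inter> X \<subset> ends f" by blast
      hence "card (ends f \<inter> X) < 2" using psubset_card_mono[OF fe[OF fE]] card_ends[OF fE] by metis
      thus ?thesis using False by auto
    qed
  qed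
  also have "\<dots> = 2 * card ?I + card ?B"
    using fin by (simp add: sum.distrib sum.If_cases Int_def)
  finally show ?thesis by (simp add: boundary_edges_def conj_assoc)
qed

lemma ex_total_colouring:
  "\<exists>K \<psi>. partial_edge_colouring E ends K \<psi> \<and> (\<forall>e\<in>E. \<psi> e \<noteq> None)"
proof -
  obtain h where h: "bij_betw h E {0..<card E}" using ex_bij_betw_finite_nat[OF finite_E] by blast
  let ?\<psi> = "\<lambda>f. Some (Suc (h f))"
  have "partial_edge_colouring E ends (card E) ?\<psi>" unfolding partial_edge_colouring_def
  proof (intro conjI ballI allI impI)
    fix f c assume "f \<in> E" "?\<psi> f = Some c"
    thus "c \<in> {1..card E}" using h by (auto dest: bij_betw_apply)
  next
    fix f g assume "f \<in> E" "g \<in> E" "f \<noteq> g \<and> ends f \<inter> ends g \<noteq> {} \<and> ?\<psi> f \<noteq> None"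
    thus "?\<psi> f \<noteq> ?\<psi> g" using h by (auto simp: bij_betw_def dest: inj_onD)
  qed
  thus ?thesis by blast
qed

text \<open>In an optimal colouring each colour has at most \<open>(card S - 1) / 2\<close> edges
  inside an odd set \<open>S\<close>. Hence the first inequality of (3) always holds, and the
  failure of (3) means that \<open>rho\<close> is at most \<open>k\<close>.\<close>

lemma rho_le_chromatic_index:
  assumes W: "finite W"
  shows "rho W (induced_edges E ends W) ends \<le> real (chromatic_index E ends)"
proof -
  let ?K = "chromatic_index E ends"
  obtain \<psi> where \<psi>: "partial_edge_colouring E ends ?K \<psi>" "\<forall>e\<in>E. \<psi> e \<noteq> None"
    using LeastI_ex[OF ex_total_colouring] unfolding chromatic_index_def by blast
  interpret K: multigraph V E ends ?K by unfold_locales (rule multigraph)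
  let ?R = "{2 * real (card {e\<in>induced_edges E ends W. ends e \<subseteq> S}) / (real (card S) - 1) | S.
      S \<subseteq> W \<and> odd (card S) \<and> card S \<ge> 3}"
  have "r \<le> real ?K" if r: "r \<in> ?R" for r
  proof -
    obtain S where S: "S \<subseteq> W" "odd (card S)" "card S \<ge> 3"
      and r: "r = 2 * real (card {e\<in>induced_edges E ends W. ends e \<subseteq> S}) / (real (card S) - 1)"
      using r by blast
    have fS: "finite S" using S W finite_subset by blast
    let ?F = "\<lambda>c. {f\<in>E. \<psi> f = Some c \<and> ends f \<subseteq> S}"
    have le: "2 * card (?F c) \<le> card S - 1" if "c \<in> {1..?K}" for c
    proof -
      have "2 * card (?F c) \<le> card {v\<in>S. \<not> K.miss \<psi> c v}" using K.card_seeing[OF \<psi>(1) fS that] by simp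
      also have "\<dots> \<le> card S" by (rule card_mono[OF fS]) blast
      finally have "2 * card (?F c) \<le> card S" .
      moreover have "2 * card (?F c) \<noteq> card S" using S(2) by (metis dvd_triv_left)
      ultimately show ?thesis by linarith
    qed
    have "{e\<in>induced_edges E ends W. ends e \<subseteq> S} \<subseteq> (\<Union>c\<in>{1..?K}. ?F c)"
    proof
      fix f assume f: "f \<in> {e\<in>induced_edges E ends W. ends e \<subseteq> S}"
      hence fE: "f \<in> E" by (simp add: induced_edges_def)
      then obtain c where "\<psi> f = Some c" using \<psi>(2) by auto
      moreover from this have "c \<in> {1..?K}" using K.proper_range[OF \<psi>(1) fE] by blast
      ultimately show "f \<in> (\<Union>c\<in>{1..?K}. ?F c)" using f fE by auto
    qed
    hence "card {e\<in>induced_edges E ends W. ends e \<subseteq> S} \<le> card (\<Union>c\<in>{1..?K}. ?F c)"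
      by (rule card_mono[rotated]) (use finite_E in auto)
    also have "\<dots> \<le> (\<Sum>c\<in>{1..?K}. card (?F c))" by (rule card_UN_le) simp
    finally have "2 * card {e\<in>induced_edges E ends W. ends e \<subseteq> S} \<le> (\<Sum>c\<in>{1..?K}. 2 * card (?F c))"
      by (simp add: sum_distrib_left[symmetric])
    also have "\<dots> \<le> (\<Sum>c\<in>{1..?K}. card S - 1)" by (rule sum_mono) (rule le)
    also have "\<dots> = ?K * (card S - 1)" by simp
    finally have "real (2 * card {e\<in>induced_edges E ends W. ends e \<subseteq> S}) \<le> real (?K * (card S - 1))"
      by (simp only: of_nat_le_iff)
    hence "2 * real (card {e\<in>induced_edges E ends W. ends e \<subseteq> S}) \<le> real ?K * (real (card S) - 1)"
      using S(3) by (simp add: of_nat_diff)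
    thus ?thesis using S(3) unfolding r by (simp add: divide_le_eq)
  qed
  moreover have "finite ?R"
  proof -
    have "?R \<subseteq> (\<lambda>S. 2 * real (card {e\<in>induced_edges E ends W. ends e \<subseteq> S}) / (real (card S) - 1)) ` Pow W"
      by blast
    thus ?thesis by (rule finite_subset) (use W in simp)
  qed
  ultimately show ?thesis unfolding rho_def Let_def by (auto intro: Max.boundedI)
qed

lemma rho_ge:
  assumes "finite X" "S \<subseteq> X" "odd (card S)" "card S \<ge> 3"
  shows "2 * real (card {e\<in>F. ends e \<subseteq> S}) / (real (card S) - 1) \<le> rho X F ends"
proof -
  let ?R = "{2 * real (card {e\<in>F. ends e \<subseteq> S}) / (real (card S) - 1) | S.
      S \<subseteq> X \<and> odd (card S) \<and> card S \<ge> 3}"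
  have "?R \<subseteq> (\<lambda>S. 2 * real (card {e\<in>F. ends e \<subseteq> S}) / (real (card S) - 1)) ` Pow X" by blast
  hence "finite ?R" by (rule finite_subset) (use assms in simp)
  moreover have mem: "2 * real (card {e\<in>F. ends e \<subseteq> S}) / (real (card S) - 1) \<in> ?R" using assms by blast
  ultimately have le: "2 * real (card {e\<in>F. ends e \<subseteq> S}) / (real (card S) - 1) \<le> Max ?R" by (rule Max_ge)
  have "?R \<noteq> {}" using mem by blast
  thus ?thesis unfolding rho_def Let_def using le by (subst if_not_P)
qed

section \<open>Tashkinov trees as lists, and their closure\<close>

lemma tashkinov_treeD:
  assumes "tashkinov_tree E ends k \<phi> e0 ts" "i < length ts"
  defines "X \<equiv> tree_vertices ends e0 (take i ts)"
  shows "fst (ts ! i) \<in> E" "snd (ts ! i) \<notin> X" "\<exists>x\<in>X. ends (fst (ts ! i)) = {x, snd (ts ! i)}"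
    "\<exists>\<gamma>. \<phi> (fst (ts ! i)) = Some \<gamma> \<and> (\<exists>y\<in>X. miss \<phi> \<gamma> y)"
  using assms unfolding tashkinov_tree_def Let_def by blast+

lemma tree_vertices_take:
  assumes "i < length ts"
  shows "tree_vertices ends e0 (take (Suc i) ts) = insert (snd (ts ! i)) (tree_vertices ends e0 (take i ts))"
  using assms by (simp add: tree_vertices_def take_Suc_conv_app_nth)

lemma tree_vertices_take_subset: "tree_vertices ends e0 (take i ts) \<subseteq> tree_vertices ends e0 ts"
  unfolding tree_vertices_def using set_take_subset by fastforce

lemma tree_vertices_subset_W:
  assumes T: "tashkinov_tree E ends k \<phi> e0 ts"
  shows "tree_vertices ends e0 ts \<subseteq> tashkinov_W E ends k \<phi> e0"
proof -
  have "i \<le> length ts \<Longrightarrow> tree_vertices ends e0 (take i ts) \<subseteq> tashkinov_W E ends k \<phi> e0" for i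
  proof (induction i)
    case 0 thus ?case by (auto simp: tree_vertices_def intro: tashkinov_W.base)
  next
    case (Suc i)
    hence i: "i < length ts" by simp
    note D = tashkinov_treeD[OF T i]
    have sub: "tree_vertices ends e0 (take i ts) \<subseteq> tashkinov_W E ends k \<phi> e0" using Suc by simp
    obtain x \<gamma> y where "x \<in> tashkinov_W E ends k \<phi> e0" "ends (fst (ts ! i)) = {x, snd (ts ! i)}"
      "\<phi> (fst (ts ! i)) = Some \<gamma>" "y \<in> tashkinov_W E ends k \<phi> e0" "miss \<phi> \<gamma> y"
      using D(3,4) sub by blast
    hence "snd (ts ! i) \<in> tashkinov_W E ends k \<phi> e0" using tashkinov_W.step D(1) by metis
    thus ?case using tree_vertices_take[OF i] Suc by auto
  qed
  from this[of "length ts"] show ?thesis by simp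
qed

text \<open>Forbidding one more pair is enough: a closure step leading out of the tree could itself
  be appended.\<close>

lemma W_subset_maximal_tree:
  assumes "maximal_tashkinov_tree E ends k \<phi> e0 ts"
  shows "tashkinov_W E ends k \<phi> e0 \<subseteq> tree_vertices ends e0 ts"
proof
  have T: "tashkinov_tree E ends k \<phi> e0 ts"
    and max: "\<not> (\<exists>e v. tashkinov_tree E ends k \<phi> e0 (ts @ [(e, v)]))"
    using assms by (auto simp: maximal_tashkinov_tree_def)
  fix v assume "v \<in> tashkinov_W E ends k \<phi> e0"
  thus "v \<in> tree_vertices ends e0 ts"
  proof induction
    case (base x) thus ?case by (simp add: tree_vertices_def)
  next
    case (step x e v \<gamma> y)
    show ?case
    proof (rule ccontr)
      assume v: "v \<notin> tree_vertices ends e0 ts"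
      have "tashkinov_tree E ends k \<phi> e0 (ts @ [(e, v)])" unfolding tashkinov_tree_def Let_def
      proof (intro conjI allI impI)
        fix i assume "i < length (ts @ [(e, v)])"
        hence i: "i < length ts \<or> i = length ts" by auto
        let ?X = "tree_vertices ends e0 (take i (ts @ [(e, v)]))"
        have "fst ((ts @ [(e, v)]) ! i) \<in> E \<and> snd ((ts @ [(e, v)]) ! i) \<notin> ?X \<and>
           (\<exists>x\<in>?X. ends (fst ((ts @ [(e, v)]) ! i)) = {x, snd ((ts @ [(e, v)]) ! i)}) \<and>
           (\<exists>\<gamma>. \<phi> (fst ((ts @ [(e, v)]) ! i)) = Some \<gamma> \<and> (\<exists>y\<in>?X. miss \<phi> \<gamma> y))"
          using i
        proof
          assume "i < length ts"
          thus ?thesis using tashkinov_treeD[OF T, of i] by (simp add: nth_append)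
        next
          assume "i = length ts"
          thus ?thesis using step v by auto
        qed
        thus "fst ((ts @ [(e, v)]) ! i) \<in> E" "snd ((ts @ [(e, v)]) ! i) \<notin> ?X"
          "\<exists>x\<in>?X. ends (fst ((ts @ [(e, v)]) ! i)) = {x, snd ((ts @ [(e, v)]) ! i)}"
          "\<exists>\<gamma>. \<phi> (fst ((ts @ [(e, v)]) ! i)) = Some \<gamma> \<and> (\<exists>y\<in>?X. miss \<phi> \<gamma> y)"
          by blast+
      qed (use T in \<open>simp add: tashkinov_tree_def\<close>)
      thus False using max by blast
    qed
  qed
qed

lemma W_closed:
  assumes "x \<in> tashkinov_W E ends k \<phi> e0" "f \<in> E" "x \<in> ends f" "\<phi> f = Some \<gamma>"
    "\<gamma> \<in> missing_colours E ends k \<phi> (tashkinov_W E ends k \<phi> e0)"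
  shows "ends f \<subseteq> tashkinov_W E ends k \<phi> e0"
proof -
  obtain v where v: "ends f = {x, v}" using ends_other[OF assms(2,3)] by blast
  obtain y where "y \<in> tashkinov_W E ends k \<phi> e0" "miss \<phi> \<gamma> y"
    using assms(5) by (auto simp: missing_colours_def)
  hence "v \<in> tashkinov_W E ends k \<phi> e0" using tashkinov_W.step[OF assms(1,2) v assms(4)] by blast
  thus ?thesis using v assms(1) by simp
qed

lemma boundary_edgeE:
  assumes "f \<in> boundary_edges E ends \<phi> X c"
  obtains x w where "f \<in> E" "\<phi> f = Some c" "ends f = {x, w}" "x \<in> X" "w \<notin> X"
proof -
  have f: "f \<in> E" "\<phi> f = Some c" "card (ends f \<inter> X) = 1" using assms by (auto simp: boundary_edges_def)
  obtain x where x: "ends f \<inter> X = {x}" using f(3) by (meson card_1_singletonE)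
  hence xf: "x \<in> ends f" "x \<in> X" by auto
  obtain w where w: "w \<noteq> x" "ends f = {x, w}" using ends_other[OF f(1) xf(1)] by metis
  hence "w \<notin> X" using x by auto
  thus ?thesis using that f w xf by blast
qed

end

context kempe_class
begin

lemma tashkinov_tree_imp_tree:
  assumes T: "tashkinov_tree E ends k \<phi> e0 ts"
  obtains y e where "tree \<phi> y e (Suc (length ts))" "tree_vertices ends e0 ts = y ` {..Suc (length ts)}"
proof -
  obtain a b where ab: "ends e0 = {a, b}" "a \<noteq> b" using card_ends[OF e0] by (meson card_2_iff)
  \<comment> \<open>The ends of \<open>e0\<close> get the numbers 0 and 1 and list entry
    \<open>l\<close> gets \<open>l + 2\<close>, so the last index is
    \<open>Suc (length ts)\<close>.\<close>
  define y where "y j = (if j = 0 then a else if j = 1 then b else snd (ts ! (j - 2)))" for j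
  define e where "e j = fst (ts ! (j - 2))" for j
  have vert: "i \<le> length ts \<Longrightarrow> tree_vertices ends e0 (take i ts) = y ` {..Suc i}" for i
  proof (induction i)
    case 0
    have "{..Suc 0} = {0, 1}" by auto
    thus ?case using ab by (auto simp: tree_vertices_def y_def)
  next
    case (Suc i)
    have "y (Suc (Suc i)) = snd (ts ! i)" by (simp add: y_def)
    thus ?case using tree_vertices_take[of i ts e0] Suc by (simp add: atMost_Suc)
  qed
  have "tree \<phi> y e (Suc (length ts))" unfolding tree_def
  proof (intro conjI ballI)
    show "ends e0 = {y 0, y 1}" using ab by (simp add: y_def)
    have new: "y j \<noteq> y i" if "i < j" "j \<le> Suc (length ts)" for i j
    proof (cases "j = 1")
      case True thus ?thesis using that ab by (simp add: y_def)
    next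
      case False
      define l where "l = j - 2"
      have l: "j = l + 2" "l < length ts" using that False by (auto simp: l_def)
      have "y j \<notin> y ` {..Suc l}"
        using tashkinov_treeD(2)[OF T l(2)] vert[of l] l by (simp add: y_def)
      thus ?thesis using that l by auto
    qed
    show "inj_on y {..Suc (length ts)}"
      by (rule inj_onI) (metis atMost_iff linorder_neqE_nat new)
    fix j assume j: "j \<in> {2..Suc (length ts)}"
    define l where "l = j - 2"
    have l: "j = l + 2" "l < length ts" using j by (auto simp: l_def)
    have yj: "y j = snd (ts ! l)" and ej: "e j = fst (ts ! l)" using l by (simp_all add: y_def e_def)
    note D = tashkinov_treeD[OF T l(2)]
    have X: "tree_vertices ends e0 (take l ts) = y ` {..Suc l}" using vert l by simp
    show "e j \<in> E" using D(1) ej by simp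
    have lt: "i < j" if "i \<le> Suc l" for i using that l by simp
    obtain i where "i \<le> Suc l" "ends (e j) = {y i, y j}" using D(3) unfolding X yj ej by auto
    thus "\<exists>i<j. ends (e j) = {y i, y j}" using lt by blast
    obtain c i where "\<phi> (e j) = Some c" "i \<le> Suc l" "miss \<phi> c (y i)" using D(4) unfolding X ej by auto
    thus "\<exists>c. \<phi> (e j) = Some c \<and> (\<exists>i<j. miss \<phi> c (y i))" using lt by blast
  qed
  moreover have "tree_vertices ends e0 ts = y ` {..Suc (length ts)}" using vert[of "length ts"] by simp
  ultimately show ?thesis using that by blast
qed

lemma card_tree_colours:
  assumes "R \<phi>"
  shows "card (tree_colours \<phi> e0 ts) \<le> length ts"
proof -
  have "tree_colours \<phi> e0 ts \<subseteq> (\<lambda>f. the (\<phi> f)) ` (fst ` set ts)"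
  proof
    fix c assume "c \<in> tree_colours \<phi> e0 ts"
    then obtain f where f: "f \<in> insert e0 (fst ` set ts)" "\<phi> f = Some c" by (auto simp: tree_colours_def)
    hence "f \<in> fst ` set ts" using R_e0[OF assms] by auto
    thus "c \<in> (\<lambda>f. the (\<phi> f)) ` (fst ` set ts)" using f by (metis imageI option.sel)
  qed
  hence "card (tree_colours \<phi> e0 ts) \<le> card ((\<lambda>f. the (\<phi> f)) ` (fst ` set ts))" by (rule card_mono[rotated]) simp
  also have "\<dots> \<le> card (fst ` set ts)" by (rule card_image_le) simp
  also have "\<dots> \<le> card (set ts)" by (rule card_image_le) simp
  also have "\<dots> \<le> length ts" by (rule card_length)
  finally show ?thesis .
qed

text \<open>The vertices miss at least \<open>length ts + 3\<close> colours and the edges use at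
  most \<open>length ts\<close>, which leaves room to avoid \<beta> as well.\<close>

lemma ex_free_colour_neq:
  assumes R: "R \<phi>" and T: "tashkinov_tree E ends k \<phi> e0 ts"
  obtains \<mu> x where "\<mu> \<notin> tree_colours \<phi> e0 ts" "\<mu> \<noteq> \<beta>" "x \<in> tree_vertices ends e0 ts" "miss \<phi> \<mu> x"
proof -
  obtain y e where t: "tree \<phi> y e (Suc (length ts))" "tree_vertices ends e0 ts = y ` {..Suc (length ts)}"
    using tashkinov_tree_imp_tree[OF T] .
  let ?M = "\<Union>i\<le>Suc (length ts). {c. miss \<phi> c (y i)}"
  let ?U = "insert \<beta> (tree_colours \<phi> e0 ts)"
  have "length ts + 3 \<le> card ?M" using card_missing_tree[OF R t(1) tree_elementary[OF R t(1)]] by simp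
  moreover have fin: "finite (tree_colours \<phi> e0 ts)"
  proof (rule finite_subset)
    show "tree_colours \<phi> e0 ts \<subseteq> (\<lambda>f. the (\<phi> f)) ` insert e0 (fst ` set ts)"
      by (auto simp: tree_colours_def image_iff) (metis fst_conv option.sel)+
  qed simp
  moreover have "card ?U \<le> Suc (length ts)"
    using card_tree_colours[OF R, of ts] fin by (simp add: card_insert_if)
  ultimately have "\<not> ?M \<subseteq> ?U" using card_mono[of ?U ?M] by auto
  then obtain \<mu> where "\<mu> \<in> ?M" "\<mu> \<notin> ?U" by blast
  thus ?thesis using that t(2) by auto
qed

end

section \<open>Boundary edges and the first excursion\<close>

text \<open>\<open>T\<close> is only a list with vertex set \<open>W\<close>; which colourings make
  it a Tashkinov tree is left to \<open>good\<close>, so that the colouring can vary over a fixed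
  \<open>T\<close>. \<open>W_max\<close> is the failure of statement (2).\<close>

locale maximum_tashkinov_tree = kempe_class V E ends k e0 R
  for V :: "'v set" and E :: "'e set" and ends k e0 R +
  fixes T :: "('e \<times> 'v) list" and W :: "'v set"
  assumes T_W: "tree_vertices ends e0 T = W"
    and W_max: "R \<phi> \<Longrightarrow> card (tashkinov_W E ends k \<phi> e0) \<le> card W"
begin

text \<open>By maximality of \<open>W\<close>, a good colouring again has \<open>W\<close> as its Tashkinov closure.\<close>

definition good :: "('e \<Rightarrow> nat option) \<Rightarrow> bool" where
  "good \<phi> \<longleftrightarrow> R \<phi> \<and> tashkinov_tree E ends k \<phi> e0 T"

abbreviation used :: "('e \<Rightarrow> nat option) \<Rightarrow> nat set" where
  "used \<phi> \<equiv> tree_colours \<phi> e0 T"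

abbreviation missW :: "('e \<Rightarrow> nat option) \<Rightarrow> nat set" where
  "missW \<phi> \<equiv> missing_colours E ends k \<phi> W"

lemma good_R: "good \<phi> \<Longrightarrow> R \<phi>" and good_tree: "good \<phi> \<Longrightarrow> tashkinov_tree E ends k \<phi> e0 T"
  by (auto simp: good_def)

lemma good_proper: "good \<phi> \<Longrightarrow> proper \<phi>"
  using good_R R_proper by blast

lemma good_W:
  assumes "good \<phi>"
  shows "tashkinov_W E ends k \<phi> e0 = W"
proof -
  have "tashkinov_W E ends k \<phi> e0 \<subseteq> V"
  proof
    fix v assume "v \<in> tashkinov_W E ends k \<phi> e0"
    thus "v \<in> V" by induction (use ends_subset_V e0 in blast)+
  qed
  hence "finite (tashkinov_W E ends k \<phi> e0)" using finite_V finite_subset by blast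
  moreover have "W \<subseteq> tashkinov_W E ends k \<phi> e0"
    using tree_vertices_subset_W[OF good_tree[OF assms]] T_W by simp
  ultimately show ?thesis using W_max[OF good_R[OF assms]] by (metis card_seteq)
qed

lemma finite_W: "finite W"
proof -
  have "finite (ends e0)" using card_ends[OF e0] by (simp add: card_ge_0_finite)
  hence "finite (tree_vertices ends e0 T)" by (simp add: tree_vertices_def)
  thus ?thesis using T_W by simp
qed

lemma good_closed:
  assumes "good \<phi>" "x \<in> W" "f \<in> E" "x \<in> ends f" "\<phi> f = Some \<gamma>" "\<gamma> \<in> missW \<phi>"
  shows "ends f \<subseteq> W"
  using W_closed[of x \<phi> e0 f \<gamma>] assms good_W[OF assms(1)] by simp

lemma good_elementary:
  assumes "good \<phi>"
  shows "elementary E ends k \<phi> W"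
proof -
  obtain y e where "tree \<phi> y e (Suc (length T))" "tree_vertices ends e0 T = y ` {..Suc (length T)}"
    using tashkinov_tree_imp_tree[OF good_tree[OF assms]] .
  thus ?thesis using tree_elementary[OF good_R[OF assms]] T_W by metis
qed

lemma tree_edge_in_W:
  assumes "good \<phi>" "f \<in> fst ` set T"
  shows "f \<in> E" "ends f \<subseteq> W" "\<exists>c. \<phi> f = Some c \<and> c \<in> missW \<phi>"
proof -
  obtain i where i: "i < length T" "f = fst (T ! i)" using assms(2) by (metis imageE in_set_conv_nth)
  note D = tashkinov_treeD[OF good_tree[OF assms(1)] i(1)]
  have sub: "tree_vertices ends e0 (take i T) \<subseteq> W" using tree_vertices_take_subset T_W by blast
  have "snd (T ! i) \<in> W" using T_W i(1) by (auto simp: tree_vertices_def)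
  thus "f \<in> E" "ends f \<subseteq> W" using D(1,3) sub i by auto
  show "\<exists>c. \<phi> f = Some c \<and> c \<in> missW \<phi>" using D(4) sub i by (auto simp: missing_colours_def)
qed

lemma used_missW:
  assumes g: "good \<phi>"
  shows "used \<phi> \<subseteq> missW \<phi>"
proof
  fix c assume "c \<in> used \<phi>"
  then obtain f where f: "f \<in> insert e0 (fst ` set T)" "\<phi> f = Some c" unfolding tree_colours_def by blast
  hence "f \<in> fst ` set T" using R_e0[OF good_R[OF g]] by auto
  thus "c \<in> missW \<phi>" using tree_edge_in_W(3)[OF g] f(2) by fastforce
qed

lemma good_cong:
  assumes g: "good \<phi>" and R': "R \<phi>'" and same: "\<And>f. f \<in> fst ` set T \<Longrightarrow> \<phi>' f = \<phi> f"
    and miss: "\<And>c x. c \<in> used \<phi> \<Longrightarrow> x \<in> W \<Longrightarrow> miss \<phi> c x \<Longrightarrow> miss \<phi>' c x"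
  shows "good \<phi>'" "used \<phi>' = used \<phi>"
proof -
  have "tashkinov_tree E ends k \<phi>' e0 T" unfolding tashkinov_tree_def Let_def
  proof (intro conjI allI impI)
    fix i assume i: "i < length T"
    let ?X = "tree_vertices ends e0 (take i T)"
    note D = tashkinov_treeD[OF good_tree[OF g] i]
    show "fst (T ! i) \<in> E" "snd (T ! i) \<notin> ?X" "\<exists>x\<in>?X. ends (fst (T ! i)) = {x, snd (T ! i)}"
      using D by blast+
    obtain \<gamma> x where x: "\<phi> (fst (T ! i)) = Some \<gamma>" "x \<in> ?X" "miss \<phi> \<gamma> x" using D(4) by blast
    have "\<gamma> \<in> used \<phi>" using x i unfolding tree_colours_def by force
    moreover have "x \<in> W" using x tree_vertices_take_subset T_W by blast
    ultimately have "miss \<phi>' \<gamma> x" using miss x by blast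
    thus "\<exists>\<gamma>. \<phi>' (fst (T ! i)) = Some \<gamma> \<and> (\<exists>y\<in>?X. miss \<phi>' \<gamma> y)" using same[of "fst (T ! i)"] x i by force
  qed (rule e0)
  thus "good \<phi>'" using R' by (simp add: good_def)
  show "used \<phi>' = used \<phi>"
    using same R_e0[OF R'] R_e0[OF good_R[OF g]] unfolding tree_colours_def by auto
qed

text \<open>Of the two kinds of swap that keep \<open>T\<close> a tree, this one may run anywhere,
  even through \<open>W\<close>, because its colours avoid the edges of \<open>T\<close>.\<close>

lemma good_kswap_unused:
  assumes g: "good \<phi>" and ab: "a \<in> {1..k}" "b \<in> {1..k}" "a \<noteq> b" "a \<notin> used \<phi>" "b \<notin> used \<phi>"
  shows "good (kswap \<phi> a b v)" "used (kswap \<phi> a b v) = used \<phi>"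
proof -
  have same: "kswap \<phi> a b v f = \<phi> f" if "f \<in> fst ` set T" for f
  proof (rule kswap_other)
    show "\<phi> f \<noteq> Some a" "\<phi> f \<noteq> Some b" using that ab(4,5) unfolding tree_colours_def by auto
  qed
  have miss: "miss (kswap \<phi> a b v) c x" if "c \<in> used \<phi>" "x \<in> W" "miss \<phi> c x" for c x
    using that ab(4,5) by (subst miss_kswap_other) auto
  show "good (kswap \<phi> a b v)" "used (kswap \<phi> a b v) = used \<phi>"
    by (rule good_cong[OF g R_kswap[OF good_R[OF g] ab(1-3)]]; fact same miss)+
qed

lemma vcomp_outside:
  assumes g: "good \<phi>" and ab: "a \<in> missW \<phi>" "b \<in> missW \<phi>" and v: "v \<notin> W"
  shows "vcomp \<phi> a b v \<inter> W = {}"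
proof -
  have "vcomp \<phi> a b v \<subseteq> - W"
  proof (rule vcomp_subset)
    fix f x z assume f: "f \<in> ab_edges E \<phi> a b" "x \<in> ends f" "x \<in> - W" "z \<in> ends f"
    show "z \<in> - W"
    proof
      assume "z \<in> W"
      moreover obtain c where "f \<in> E" "\<phi> f = Some c" "c \<in> missW \<phi>" using f ab by (auto simp: ab_edges_def)
      ultimately have "ends f \<subseteq> W" using good_closed[OF g _ _ f(4)] by blast
      thus False using f by blast
    qed
  qed (use v in simp)
  thus ?thesis by blast
qed

text \<open>The other kind: colours missing on \<open>W\<close> never cross its boundary, so the
  chain of an outside vertex stays outside, and the colours may well occur on
  \<open>T\<close>.\<close>

lemma good_kswap_outside:
  assumes g: "good \<phi>" and ab: "a \<in> missW \<phi>" "b \<in> missW \<phi>" "a \<noteq> b" and v: "v \<notin> W"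
  shows "good (kswap \<phi> a b v)" "used (kswap \<phi> a b v) = used \<phi>"
    "x \<in> W \<Longrightarrow> miss (kswap \<phi> a b v) c x \<longleftrightarrow> miss \<phi> c x"
    "ends f \<inter> W \<noteq> {} \<Longrightarrow> kswap \<phi> a b v f = \<phi> f"
proof -
  have out: "x \<notin> vcomp \<phi> a b v" if "x \<in> W" for x using vcomp_outside[OF g ab(1,2) v] that by blast
  have r: "a \<in> {1..k}" "b \<in> {1..k}" using ab miss_range by (auto simp: missing_colours_def)
  show m: "miss (kswap \<phi> a b v) c x \<longleftrightarrow> miss \<phi> c x" if "x \<in> W" for c x using miss_kswap_out[OF out[OF that]] .
  show s: "kswap \<phi> a b v f = \<phi> f" if "ends f \<inter> W \<noteq> {}" for f using kswap_out out that by blast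
  have "kswap \<phi> a b v f = \<phi> f" if "f \<in> fst ` set T" for f
  proof (rule s)
    have "ends f \<subseteq> W" "ends f \<noteq> {}" using tree_edge_in_W[OF g that] card_ends[of f] by auto
    thus "ends f \<inter> W \<noteq> {}" by blast
  qed
  thus "good (kswap \<phi> a b v)" "used (kswap \<phi> a b v) = used \<phi>"
    using good_cong[OF g R_kswap[OF good_R[OF g] r ab(3)]] m by blast+
qed

section \<open>Parity of the boundary and defective colours\<close>

lemma missW_no_boundary:
  assumes g: "good \<phi>" and c: "c \<in> missW \<phi>"
  shows "boundary_edges E ends \<phi> W c = {}"
proof (rule ccontr)
  assume "boundary_edges E ends \<phi> W c \<noteq> {}"
  then obtain f where "f \<in> boundary_edges E ends \<phi> W c" by blast
  then obtain x w where "f \<in> E" "\<phi> f = Some c" "ends f = {x, w}" "x \<in> W" "w \<notin> W"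
    by (rule boundary_edgeE)
  thus False using good_closed[OF g, of x f c] c by auto
qed

lemma ends_e0_W: "ends e0 \<subseteq> W"
  using T_W by (auto simp: tree_vertices_def)

text \<open>By elementarity exactly one vertex of \<open>W\<close> misses \<open>c\<close>, and no
  edge coloured \<open>c\<close> leaves \<open>W\<close>, so the colour matches up all other
  vertices inside \<open>W\<close>.\<close>

lemma card_W:
  assumes g: "good \<phi>" and c: "c \<in> missW \<phi>"
  shows "card W = 2 * card {f\<in>E. \<phi> f = Some c \<and> ends f \<subseteq> W} + 1"
proof -
  obtain v where v: "v \<in> W" "miss \<phi> c v" using c by (auto simp: missing_colours_def)
  have "{x\<in>W. \<not> miss \<phi> c x} = W - {v}"
    using v elementaryD[OF good_elementary[OF g] _ v(1) _ v(2)] by blast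
  moreover have "card W > 0" using v finite_W by (auto simp: card_gt_0_iff)
  ultimately have "card {x\<in>W. \<not> miss \<phi> c x} + 1 = card W" using v finite_W by simp
  thus ?thesis
    using card_seeing[OF good_proper[OF g] finite_W miss_range[OF v(2)]] missW_no_boundary[OF g c] by simp
qed

lemma odd_card_W:
  assumes g: "good \<phi>"
  shows "odd (card W)"
proof -
  obtain x where x: "x \<in> ends e0" using card_ends[OF e0] by fastforce
  hence "x \<in> V" "x \<in> W" using ends_subset_V e0 ends_e0_W by blast+
  moreover obtain c where "miss \<phi> c x" using ex_missing[OF good_R[OF g] \<open>x \<in> V\<close>] .
  ultimately have "c \<in> missW \<phi>" by (auto simp: missing_colours_def)
  thus ?thesis using card_W[OF g] by simp
qed

lemma card_W_boundary:
  assumes g: "good \<phi>" and c: "c \<in> {1..k}" "c \<notin> missW \<phi>"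
  shows "card W = 2 * card {f\<in>E. \<phi> f = Some c \<and> ends f \<subseteq> W} + card (boundary_edges E ends \<phi> W c)"
proof -
  have "{x\<in>W. \<not> miss \<phi> c x} = W" using c by (auto simp: missing_colours_def)
  thus ?thesis using card_seeing[OF good_proper[OF g] finite_W c(1)] by simp
qed

lemma defective_not_missW:
  assumes "good \<phi>" "defective E ends \<phi> W c"
  shows "c \<notin> missW \<phi>" "c \<in> {1..k}"
proof -
  show "c \<notin> missW \<phi>" using missW_no_boundary[OF assms(1)] assms(2) by (auto simp: defective_def)
  have "boundary_edges E ends \<phi> W c \<noteq> {}" using assms(2) by (auto simp: defective_def)
  then obtain f where "f \<in> E" "\<phi> f = Some c" by (auto simp: boundary_edges_def)
  thus "c \<in> {1..k}" using proper_range[OF good_proper[OF assms(1)]] by blast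
qed

lemma odd_defective:
  assumes g: "good \<phi>" and c: "defective E ends \<phi> W c"
  shows "odd (card (boundary_edges E ends \<phi> W c))"
  using odd_card_W[OF g] unfolding card_W_boundary[OF g defective_not_missW(2,1)[OF g c]] by simp

text \<open>Without defective colours each of the \<open>k\<close> colours has exactly
  \<open>(card W - 1) / 2\<close> edges inside \<open>W\<close>, since a colour not missing on
  \<open>W\<close> crosses the boundary an odd number of times, hence once. The uncoloured
  \<open>e0\<close> is one edge more and pushes \<open>rho\<close> above \<open>k\<close>.\<close>

lemma ex_defective:
  assumes g: "good \<phi>" and rho: "rho W (induced_edges E ends W) ends \<le> real k"
  shows "defective_colours E ends \<phi> W \<noteq> {}"
proof
  assume none: "defective_colours E ends \<phi> W = {}"
  let ?F = "\<lambda>c. {f\<in>E. \<phi> f = Some c \<and> ends f \<subseteq> W}"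
  have odd: "odd (card W)" using odd_card_W[OF g] .
  have "card (ends e0) \<le> card W" by (rule card_mono[OF finite_W ends_e0_W])
  hence c3: "card W \<ge> 3" using card_ends[OF e0] odd by (cases "card W = 2") auto
  have each: "2 * card (?F c) = card W - 1" if c: "c \<in> {1..k}" for c
  proof (cases "c \<in> missW \<phi>")
    case True thus ?thesis using card_W[OF g] by simp
  next
    case False
    have "c \<notin> defective_colours E ends \<phi> W" using none by simp
    hence "card (boundary_edges E ends \<phi> W c) \<le> 1" by (simp add: defective_colours_def defective_def)
    moreover have "odd (card (boundary_edges E ends \<phi> W c))"
      using odd unfolding card_W_boundary[OF g c False] by simp
    ultimately have "card (boundary_edges E ends \<phi> W c) = 1"
      by (cases "card (boundary_edges E ends \<phi> W c) = 0") auto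
    thus ?thesis using card_W_boundary[OF g c False] by simp
  qed
  let ?I = "{e\<in>induced_edges E ends W. ends e \<subseteq> W}"
  have fin: "finite ?I" using finite_E by (simp add: induced_edges_def)
  have sub: "insert e0 (\<Union>c\<in>{1..k}. ?F c) \<subseteq> ?I" using e0 ends_e0_W by (auto simp: induced_edges_def)
  have "e0 \<notin> (\<Union>c\<in>{1..k}. ?F c)" using R_e0[OF good_R[OF g]] by auto
  moreover have "finite (\<Union>c\<in>{1..k}. ?F c)" using finite_E by auto
  ultimately have "Suc (card (\<Union>c\<in>{1..k}. ?F c)) \<le> card ?I" using card_mono[OF fin sub] by simp
  moreover have "card (\<Union>c\<in>{1..k}. ?F c) = (\<Sum>c\<in>{1..k}. card (?F c))"
    by (rule card_UN_disjoint) (use finite_E in auto)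
  ultimately have "2 * (\<Sum>c\<in>{1..k}. card (?F c)) < 2 * card ?I" by linarith
  moreover have "2 * (\<Sum>c\<in>{1..k}. card (?F c)) = k * (card W - 1)"
    unfolding sum_distrib_left using each by simp
  ultimately have "real (k * (card W - 1)) < real (2 * card ?I)" by (simp only: of_nat_less_iff)
  hence "real k * (real (card W) - 1) < 2 * real (card ?I)" using c3 by (simp add: of_nat_diff)
  hence "real k < 2 * real (card ?I) / (real (card W) - 1)" using c3 by (simp add: less_divide_eq)
  also have "\<dots> \<le> rho W (induced_edges E ends W) ends" by (rule rho_ge[OF finite_W order_refl odd c3])
  finally show False using rho by simp
qed

text \<open>Otherwise swapping \<open>\<alpha>\<close> and \<open>\<beta>\<close> at the exit would give a boundary edge of the colour \<open>\<beta>\<close> missing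
  at \<open>u\<close>, enlarging the closure.\<close>

lemma boundary_in_chain:
  assumes g: "good \<phi>" and u: "u \<in> W" "miss \<phi> \<beta> u" and b: "\<beta> \<notin> used \<phi>"
    and f: "f \<in> boundary_edges E ends \<phi> W \<alpha>" "x \<in> ends f" "x \<in> W"
  shows "x \<in> vcomp \<phi> \<alpha> \<beta> u"
proof (rule ccontr)
  assume "x \<notin> vcomp \<phi> \<alpha> \<beta> u"
  hence out: "u \<notin> vcomp \<phi> \<alpha> \<beta> x" using vcomp_sym by blast
  have fE: "f \<in> E" "\<phi> f = Some \<alpha>" using f by (auto simp: boundary_edges_def)
  have bM: "\<beta> \<in> missW \<phi>" using u by (auto simp: missing_colours_def)
  have a: "\<alpha> \<notin> missW \<phi>" using missW_no_boundary[OF g] f by blast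
  hence ne: "\<alpha> \<noteq> \<beta>" "\<alpha> \<notin> used \<phi>" using bM used_missW[OF g] by auto
  have r: "\<alpha> \<in> {1..k}" "\<beta> \<in> {1..k}" using proper_range[OF good_proper[OF g] fE] miss_range[OF u(2)] by auto
  let ?\<phi> = "kswap \<phi> \<alpha> \<beta> x"
  have g': "good ?\<phi>" using good_kswap_unused[OF g r ne b] by blast
  have "miss ?\<phi> \<beta> u" using miss_kswap_out[OF out] u by simp
  moreover have "?\<phi> f = Some \<beta>" using kswap_in[OF fE(1) f(2) vcomp_self] fE by simp
  ultimately have "f \<in> boundary_edges E ends ?\<phi> W \<beta>" "\<beta> \<in> missW ?\<phi>"
    using f u by (auto simp: boundary_edges_def missing_colours_def)
  thus False using missW_no_boundary[OF g'] by blast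
qed

section \<open>The alternating path and the boundary of \<open>W\<close>\<close>

lemma boundary_subset_path:
  assumes g: "good \<phi>" and u: "u \<in> W" "miss \<phi> \<beta> u" and b: "\<beta> \<notin> used \<phi>"
    and P: "alt_path E ends \<phi> \<alpha> \<beta> vs es" "vs ! 0 = u" "es \<noteq> []"
    and lst: "miss \<phi> \<alpha> (vs ! length es) \<or> miss \<phi> \<beta> (vs ! length es)"
  shows "boundary_edges E ends \<phi> W \<alpha> \<subseteq> set es"
proof
  have fst: "miss \<phi> \<alpha> (vs ! 0) \<or> miss \<phi> \<beta> (vs ! 0)" using u P by simp
  note pr = good_proper[OF g]
  have vc: "vcomp \<phi> \<alpha> \<beta> u = set vs" using maximal_alt_path_vcomp[OF pr P(1) fst lst P(3)] P(2) by simp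
  fix f assume f: "f \<in> boundary_edges E ends \<phi> W \<alpha>"
  then obtain x w where x: "f \<in> E" "\<phi> f = Some \<alpha>" "ends f = {x, w}" "x \<in> W" "w \<notin> W"
    by (rule boundary_edgeE)
  have "x \<in> set vs" using boundary_in_chain[OF g u b f _ x(4)] x(3) vc by auto
  thus "f \<in> set es" using alt_path_absorbs[OF pr P(1,3) fst lst, of f x] x by (auto simp: ab_edges_def)
qed

text \<open>A path that never returns to \<open>W\<close> crosses the boundary only at
  \<open>es ! (i - 1)\<close>, whereas all boundary edges of \<alpha>, at least two, lie on it. A
  colour missing at the last vertex takes the place of maximality, so that truncated paths are
  covered.\<close>

lemma no_single_exit:
  assumes g: "good \<phi>" and u: "u \<in> W" "miss \<phi> \<beta> u" and b: "\<beta> \<notin> used \<phi>"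
    and a: "defective E ends \<phi> W \<alpha>"
    and P: "alt_path E ends \<phi> \<alpha> \<beta> vs es" "vs ! 0 = u" "es \<noteq> []"
    and lst: "miss \<phi> \<alpha> (vs ! length es) \<or> miss \<phi> \<beta> (vs ! length es)"
    and inW: "\<forall>j<i. vs ! j \<in> W" and outW: "\<forall>j. i \<le> j \<and> j < length vs \<longrightarrow> vs ! j \<notin> W"
  shows False
proof -
  have "boundary_edges E ends \<phi> W \<alpha> \<subseteq> {es ! (i - 1)}"
  proof
    fix f assume f: "f \<in> boundary_edges E ends \<phi> W \<alpha>"
    then obtain x w where x: "f \<in> E" "\<phi> f = Some \<alpha>" "ends f = {x, w}" "x \<in> W" "w \<notin> W"
      by (rule boundary_edgeE)
    have "f \<in> set es" using boundary_subset_path[OF g u b P lst] f by blast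
    then obtain j where j: "j < length es" "f = es ! j" by (metis in_set_conv_nth)
    have e: "{x, w} = {vs ! j, vs ! Suc j}" and len: "length vs = Suc (length es)"
      using P(1) j x(3) by (auto simp: alt_path_def)
    have "vs ! j \<in> W \<longleftrightarrow> j < i" "vs ! Suc j \<in> W \<longleftrightarrow> Suc j < i"
      using inW outW[rule_format, of j] outW[rule_format, of "Suc j"] j len by (auto simp: not_less[symmetric])
    hence "j = i - 1" using e x(4,5) by (auto simp: doubleton_eq_iff)
    thus "f \<in> {es ! (i - 1)}" using j by simp
  qed
  hence "card (boundary_edges E ends \<phi> W \<alpha>) \<le> card {es ! (i - 1)}" by (rule card_mono[rotated]) simp
  thus False using a by (simp add: defective_def)
qed

lemma alt_path_interior_sees:
  assumes "alt_path E ends \<phi> \<alpha> \<beta> vs es" "0 < l" "l < length es"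
  shows "\<not> miss \<phi> \<alpha> (vs ! l)" "\<not> miss \<phi> \<beta> (vs ! l)"
proof -
  obtain i where i: "l = Suc i" using assms(2) by (cases l) auto
  hence "\<phi> (es ! i) \<noteq> \<phi> (es ! l)" "es ! i \<in> E" "es ! l \<in> E" "vs ! l \<in> ends (es ! i)" "vs ! l \<in> ends (es ! l)"
    "\<phi> (es ! i) = Some \<alpha> \<or> \<phi> (es ! i) = Some \<beta>" "\<phi> (es ! l) = Some \<alpha> \<or> \<phi> (es ! l) = Some \<beta>"
    using assms unfolding alt_path_def by auto
  thus "\<not> miss \<phi> \<alpha> (vs ! l)" "\<not> miss \<phi> \<beta> (vs ! l)" using missD by metis+
qed

lemma maximal_path_nonempty:
  assumes g: "good \<phi>" and u: "u \<in> W" and a: "defective E ends \<phi> W \<alpha>"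
    and P: "alt_path E ends \<phi> \<alpha> \<beta> vs es" "vs ! 0 = u"
    and max: "\<not> (\<exists>w e. alt_path E ends \<phi> \<alpha> \<beta> (vs @ [w]) (es @ [e]))"
  shows "es \<noteq> []"
proof
  assume es: "es = []"
  have "\<not> miss \<phi> \<alpha> u" using defective_not_missW(1)[OF g a] u by (auto simp: missing_colours_def)
  then obtain f where f: "f \<in> E" "u \<in> ends f" "\<phi> f = Some \<alpha>"
    using not_missE defective_not_missW(2)[OF g a] by metis
  obtain w where w: "w \<noteq> u" "ends f = {u, w}" using ends_other[OF f(1,2)] by metis
  have "vs = [u]" using P es by (auto simp: alt_path_def length_Suc_conv)
  hence "alt_path E ends \<phi> \<alpha> \<beta> (vs @ [w]) (es @ [f])"
    using alt_path_snoc[OF P(1), of f w] f w es by (auto simp: ab_edges_def)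
  thus False using max by blast
qed

end

text \<open>\<open>vs ! i\<close> is the first vertex outside \<open>W\<close>, and
  \<open>i\<close>, ..., \<open>m\<close> index an initial part of the excursion starting there.
  \<open>m < length es\<close> makes these vertices inner ones, which see both \<alpha> and
  \<beta>.\<close>

locale exit_segment = maximum_tashkinov_tree V E ends k e0 R T W
  for V :: "'v set" and E :: "'e set" and ends k e0 R T W +
  fixes \<phi> :: "'e \<Rightarrow> nat option" and \<alpha> \<beta> :: nat and u :: 'v and vs :: "'v list" and es :: "'e list"
    and i m :: nat
  assumes g: "good \<phi>" and u: "u \<in> W" "miss \<phi> \<beta> u" and b: "\<beta> \<notin> used \<phi>"
    and a: "defective E ends \<phi> W \<alpha>"
    and P: "alt_path E ends \<phi> \<alpha> \<beta> vs es" "vs ! 0 = u"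
    and m: "i \<le> m" "m < length es"
    and inW: "\<And>j. j < i \<Longrightarrow> vs ! j \<in> W" and outW: "\<And>j. i \<le> j \<Longrightarrow> j \<le> m \<Longrightarrow> vs ! j \<notin> W"
begin

text \<open>Freezing both colour classes keeps the path, the boundary edges of \<alpha> and the
  colour missing at \<open>u\<close> unchanged through any number of further swaps.\<close>

definition ok :: "('e \<Rightarrow> nat option) \<Rightarrow> bool" where
  "ok \<psi> \<longleftrightarrow> good \<psi> \<and> used \<psi> = used \<phi> \<and>
     (\<forall>f. (\<psi> f = Some \<alpha> \<longleftrightarrow> \<phi> f = Some \<alpha>) \<and> (\<psi> f = Some \<beta> \<longleftrightarrow> \<phi> f = Some \<beta>))"

lemma len: "length vs = Suc (length es)" and dist: "distinct vs"
  using P by (auto simp: alt_path_def)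

lemma i_pos: "0 < i"
  using u P outW[of 0] m by (cases i) auto

lemma vs_eq: "j \<le> length es \<Longrightarrow> l \<le> length es \<Longrightarrow> vs ! j = vs ! l \<longleftrightarrow> j = l"
  using dist len by (simp add: nth_eq_iff_index_eq)

lemma ok_self: "ok \<phi>"
  using g by (simp add: ok_def)

lemma ok_good: "ok \<psi> \<Longrightarrow> good \<psi>"
  by (simp add: ok_def)

lemma ok_facts:
  assumes "ok \<psi>"
  shows "alt_path E ends \<psi> \<alpha> \<beta> vs es" "miss \<psi> \<beta> u" "defective E ends \<psi> W \<alpha>" "\<beta> \<notin> used \<psi>"
    "\<alpha> \<notin> missW \<psi>" "\<beta> \<in> missW \<psi>" "\<alpha> \<notin> used \<psi>"
proof -
  have c: "\<psi> f = Some \<alpha> \<longleftrightarrow> \<phi> f = Some \<alpha>" "\<psi> f = Some \<beta> \<longleftrightarrow> \<phi> f = Some \<beta>" for f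
    using assms by (auto simp: ok_def)
  have e: "es ! j \<in> E \<and> ends (es ! j) = {vs ! j, vs ! Suc j} \<and> (\<phi> (es ! j) = Some \<alpha> \<or> \<phi> (es ! j) = Some \<beta>)"
    if "j < length es" for j using P that by (simp add: alt_path_def)
  have alt: "\<psi> (es ! j) \<noteq> \<psi> (es ! Suc j)" if "Suc j < length es" for j
  proof -
    have "\<phi> (es ! j) \<noteq> \<phi> (es ! Suc j)" using P that by (simp add: alt_path_def)
    thus ?thesis using e[of j] e[of "Suc j"] that c[of "es ! j"] c[of "es ! Suc j"] by auto
  qed
  show "alt_path E ends \<psi> \<alpha> \<beta> vs es"
    unfolding alt_path_def using len dist e alt by (simp add: c)
  show mu: "miss \<psi> \<beta> u" using u(2) by (simp add: missing_def c)
  show d: "defective E ends \<psi> W \<alpha>" using a by (simp add: defective_def boundary_edges_def c)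
  show "\<beta> \<notin> used \<psi>" using b assms by (simp add: ok_def)
  show "\<beta> \<in> missW \<psi>" using u(1) mu by (auto simp: missing_colours_def)
  show na: "\<alpha> \<notin> missW \<psi>" using defective_not_missW(1)[OF ok_good[OF assms] d] .
  thus "\<alpha> \<notin> used \<psi>" using used_missW[OF ok_good[OF assms]] by blast
qed

lemma ok_interior:
  assumes "ok \<psi>" "i \<le> l" "l \<le> m" "miss \<psi> c (vs ! l)"
  shows "c \<noteq> \<alpha>" "c \<noteq> \<beta>"
  using alt_path_interior_sees[OF ok_facts(1)[OF assms(1)], of l] assms m i_pos by auto

lemma ok_kswap:
  assumes "ok \<psi>" "good (kswap \<psi> c d v)" "used (kswap \<psi> c d v) = used \<psi>"
    "c \<noteq> \<alpha>" "c \<noteq> \<beta>" "d \<noteq> \<alpha>" "d \<noteq> \<beta>"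
  shows "ok (kswap \<psi> c d v)"
  using assms kswap_colour_other[of \<alpha> c d \<psi> v] kswap_colour_other[of \<beta> c d \<psi> v] by (simp add: ok_def)

text \<open>Cut at \<open>vs ! l\<close>, the path is of the kind excluded by
  \<open>no_single_exit\<close>. \<psi> need not be \<open>ok\<close>: the two colour classes may
  have changed elsewhere, so agreement is asked only for \<alpha> on edges meeting \<open>W\<close>
  and for both colours on the path before \<open>l\<close>.\<close>

lemma truncated:
  assumes gd: "good \<psi>" and "miss \<psi> \<beta> u" "\<beta> \<notin> used \<psi>"
    and bd: "\<And>f. f \<in> E \<Longrightarrow> ends f \<inter> W \<noteq> {} \<Longrightarrow> \<psi> f = Some \<alpha> \<longleftrightarrow> \<phi> f = Some \<alpha>"
    and l: "i \<le> l" "l \<le> m" and lst: "miss \<psi> \<alpha> (vs ! l) \<or> miss \<psi> \<beta> (vs ! l)"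
    and same: "\<And>j. j < l \<Longrightarrow> (\<psi> (es ! j) = Some \<alpha> \<longleftrightarrow> \<phi> (es ! j) = Some \<alpha>) \<and>
        (\<psi> (es ! j) = Some \<beta> \<longleftrightarrow> \<phi> (es ! j) = Some \<beta>)"
  shows False
proof (rule no_single_exit[OF gd u(1) assms(2,3)])
  have ll: "l \<le> length es" using l m by simp
  have "boundary_edges E ends \<psi> W \<alpha> = boundary_edges E ends \<phi> W \<alpha>"
  proof -
    have "ends f \<inter> W \<noteq> {}" if "card (ends f \<inter> W) = 1" for f using that by auto
    thus ?thesis using bd unfolding boundary_edges_def by blast
  qed
  thus "defective E ends \<psi> W \<alpha>" using a by (simp add: defective_def)
  have e: "es ! j \<in> E \<and> ends (es ! j) = {vs ! j, vs ! Suc j} \<and> (\<phi> (es ! j) = Some \<alpha> \<or> \<phi> (es ! j) = Some \<beta>)"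
    if "j < l" for j using P that ll by (simp add: alt_path_def)
  have alt: "\<psi> (es ! j) \<noteq> \<psi> (es ! Suc j)" if "Suc j < l" for j
  proof -
    have "\<phi> (es ! j) \<noteq> \<phi> (es ! Suc j)" using P that ll by (simp add: alt_path_def)
    thus ?thesis using e[of j] e[of "Suc j"] that same[of j] same[of "Suc j"] by auto
  qed
  show "alt_path E ends \<psi> \<alpha> \<beta> (take (Suc l) vs) (take l es)"
    unfolding alt_path_def using len dist ll e alt same by auto
  show "take (Suc l) vs ! 0 = u" using P(2) by simp
  show "take l es \<noteq> []" using l i_pos ll by auto
  show "miss \<psi> \<alpha> (take (Suc l) vs ! length (take l es)) \<or> miss \<psi> \<beta> (take (Suc l) vs ! length (take l es))"
    using lst ll by (simp add: min_absorb2)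
  show "\<forall>j<i. take (Suc l) vs ! j \<in> W" using inW l by simp
  show "\<forall>j. i \<le> j \<and> j < length (take (Suc l) vs) \<longrightarrow> take (Suc l) vs ! j \<notin> W" using outW l by simp
qed

lemma free_colour:
  assumes "ok \<psi>"
  obtains \<mu> y where "\<mu> \<notin> used \<psi>" "\<mu> \<noteq> \<beta>" "\<mu> \<noteq> \<alpha>" "y \<in> W" "miss \<psi> \<mu> y" "\<mu> \<in> missW \<psi>"
proof -
  obtain \<mu> y where my: "\<mu> \<notin> used \<psi>" "\<mu> \<noteq> \<beta>" "y \<in> W" "miss \<psi> \<mu> y"
    using ex_free_colour_neq[OF good_R[OF ok_good[OF assms]] good_tree[OF ok_good[OF assms]]] T_W by metis
  hence "\<mu> \<in> missW \<psi>" by (auto simp: missing_colours_def)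
  thus ?thesis using that my ok_facts(5)[OF assms] by blast
qed

text \<open>Swapping \<open>c\<close> with \<beta> on the chain of \<open>vs ! i\<close>, which
  stays outside \<open>W\<close>, makes \<beta> missing there. The path edges before index
  \<open>i\<close> all meet \<open>W\<close>, so the path survives up to this vertex and ends at
  it.\<close>

lemma first_exit_no_missW:
  assumes o: "ok \<psi>" and c: "c \<in> missW \<psi>"
  shows "\<not> miss \<psi> c (vs ! i)"
proof
  assume mi: "miss \<psi> c (vs ! i)"
  note F = ok_facts[OF o] and gd = ok_good[OF o]
  have cn: "c \<noteq> \<alpha>" "c \<noteq> \<beta>" using ok_interior[OF o _ _ mi] m by auto
  have v: "vs ! i \<notin> W" using outW m by simp
  let ?\<psi> = "kswap \<psi> \<beta> c (vs ! i)"
  note K = good_kswap_outside[OF gd F(6) c cn(2)[symmetric] v]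
  have r: "\<beta> \<in> {1..k}" "c \<in> {1..k}" using F(2) mi miss_range by blast+
  have psi: "\<psi> f = Some \<alpha> \<longleftrightarrow> \<phi> f = Some \<alpha>" "\<psi> f = Some \<beta> \<longleftrightarrow> \<phi> f = Some \<beta>" for f
    using o by (auto simp: ok_def)
  show False
  proof (rule truncated[OF K(1)])
    show "miss ?\<psi> \<beta> u" using K(3)[OF u(1)] F(2) by simp
    show "\<beta> \<notin> used ?\<psi>" using K(2) F(4) by simp
    show "?\<psi> f = Some \<alpha> \<longleftrightarrow> \<phi> f = Some \<alpha>" if "f \<in> E" "ends f \<inter> W \<noteq> {}" for f using K(4)[OF that(2)] psi by simp
    show "miss ?\<psi> \<alpha> (vs ! i) \<or> miss ?\<psi> \<beta> (vs ! i)" using miss_kswap_in[OF vcomp_self r] mi by blast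
    fix j assume j: "j < i"
    have "ends (es ! j) = {vs ! j, vs ! Suc j}" using P j m by (simp add: alt_path_def)
    hence "ends (es ! j) \<inter> W \<noteq> {}" using inW[OF j] by auto
    thus "(?\<psi> (es ! j) = Some \<alpha> \<longleftrightarrow> \<phi> (es ! j) = Some \<alpha>) \<and> (?\<psi> (es ! j) = Some \<beta> \<longleftrightarrow> \<phi> (es ! j) = Some \<beta>)"
      using K(4) psi by simp
  qed (use m in auto)
qed

text \<open>If two consecutive vertices of the segment miss \<open>\<delta>\<close>, recolouring the edge between them with
  \<open>\<delta>\<close> truncates the path.\<close>

lemma consecutive_no_common:
  assumes o: "ok \<psi>" and l: "i \<le> l" "Suc l \<le> m" and d: "miss \<psi> \<delta> (vs ! l)" "miss \<psi> \<delta> (vs ! Suc l)"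
    and dM: "\<delta> \<notin> missW \<psi>"
  shows False
proof -
  note F = ok_facts[OF o] and gd = ok_good[OF o]
  note pr = good_proper[OF gd]
  let ?f = "es ! l"
  have f: "?f \<in> E" "ends ?f = {vs ! l, vs ! Suc l}" "\<psi> ?f = Some \<alpha> \<or> \<psi> ?f = Some \<beta>"
    using F(1) l m by (auto simp: alt_path_def)
  obtain \<epsilon> where ep: "\<psi> ?f = Some \<epsilon>" "\<epsilon> = \<alpha> \<or> \<epsilon> = \<beta>" using f(3) by blast
  have dn: "\<delta> \<noteq> \<alpha>" "\<delta> \<noteq> \<beta>" using ok_interior[OF o _ _ d(1)] l by auto
  have r: "\<epsilon> \<in> {1..k}" "\<delta> \<in> {1..k}" using proper_range[OF pr f(1) ep(1)] miss_range[OF d(1)] by auto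
  have un: "\<epsilon> \<notin> used \<psi>" "\<delta> \<notin> used \<psi>" using F(4,7) ep(2) dM used_missW[OF gd] by auto
  have ed: "\<epsilon> \<noteq> \<delta>" using dn ep(2) by auto
  let ?\<psi> = "kswap \<psi> \<epsilon> \<delta> (vs ! l)"
  note K = good_kswap_unused[OF gd r ed un]
  \<comment> \<open>Both ends of \<open>?f\<close> miss \<delta>, so the chain has no further edge;
    the swap recolours \<open>?f\<close> and leaves \<open>vs ! l\<close> without
    \<epsilon>.\<close>
  have vc: "vcomp \<psi> \<epsilon> \<delta> (vs ! l) \<subseteq> {vs ! l, vs ! Suc l}"
  proof (rule vcomp_subset)
    fix h x z assume h: "h \<in> ab_edges E \<psi> \<epsilon> \<delta>" "x \<in> ends h" "x \<in> {vs ! l, vs ! Suc l}" "z \<in> ends h"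
    have "h \<in> E" "\<psi> h = Some \<epsilon>" using h d missD unfolding ab_edges_def by auto
    hence "h = ?f" using proper_unique[OF pr _ f(1) h(2)] h(3) f(2) ep(1) by auto
    thus "z \<in> {vs ! l, vs ! Suc l}" using h(4) f(2) by simp
  qed simp
  have notW: "vs ! l \<notin> W" "vs ! Suc l \<notin> W" using outW l by auto
  have outu: "x \<notin> vcomp \<psi> \<epsilon> \<delta> (vs ! l)" if "x \<in> W" for x using vc that notW by auto
  have psi: "\<psi> f = Some \<alpha> \<longleftrightarrow> \<phi> f = Some \<alpha>" "\<psi> f = Some \<beta> \<longleftrightarrow> \<phi> f = Some \<beta>" for f
    using o by (auto simp: ok_def)
  show False
  proof (rule truncated[OF K(1)])
    show "miss ?\<psi> \<beta> u" using miss_kswap_out[OF outu[OF u(1)]] F(2) by simp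
    show "\<beta> \<notin> used ?\<psi>" using K(2) F(4) by simp
    show "?\<psi> f = Some \<alpha> \<longleftrightarrow> \<phi> f = Some \<alpha>" if "f \<in> E" and fW: "ends f \<inter> W \<noteq> {}" for f
    proof -
      obtain x where "x \<in> ends f" "x \<in> W" using fW by blast
      thus ?thesis using kswap_out[OF _ outu] psi by simp
    qed
    have "miss ?\<psi> \<epsilon> (vs ! l)" using miss_kswap_in[OF vcomp_self r] d(1) by blast
    thus "miss ?\<psi> \<alpha> (vs ! l) \<or> miss ?\<psi> \<beta> (vs ! l)" using ep(2) by blast
    fix j assume j: "j < l"
    have e: "vs ! j \<in> ends (es ! j)" using P j l m by (simp add: alt_path_def)
    have "vs ! j \<noteq> vs ! l" "vs ! j \<noteq> vs ! Suc l" using vs_eq j l m by auto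
    hence "?\<psi> (es ! j) = \<psi> (es ! j)" using kswap_out[OF e] vc by blast
    thus "(?\<psi> (es ! j) = Some \<alpha> \<longleftrightarrow> \<phi> (es ! j) = Some \<alpha>) \<and> (?\<psi> (es ! j) = Some \<beta> \<longleftrightarrow> \<phi> (es ! j) = Some \<beta>)"
      using psi by simp
  qed (use l in auto)
qed

text \<open>The induction along the path ranges over all \<open>ok\<close> colourings, because its
  hypothesis is applied again after each swap.\<close>

lemma segment_no_missW:
  assumes "i \<le> l" "l \<le> m" "ok \<psi>" "c \<in> missW \<psi>"
  shows "\<not> miss \<psi> c (vs ! l)"
  using assms
proof (induction l arbitrary: \<psi> c rule: dec_induct)
  case base thus ?case using first_exit_no_missW by blast
next
  case (step l)
  note o = step.prems(2) and cM = step.prems(3)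
  have IH: "\<not> miss \<psi> c (vs ! l)" if "ok \<psi>" "c \<in> missW \<psi>" for \<psi> c using step.IH step.prems(1) that by simp
  have lm: "i \<le> Suc l" "Suc l \<le> m" "l \<le> m" using step by auto
  have notW: "vs ! l \<notin> W" "vs ! Suc l \<notin> W" using outW step.hyps lm by auto
  have dist2: "vs ! l \<noteq> vs ! Suc l" using vs_eq lm m by auto
  show ?case
  proof
    assume mc: "miss \<psi> c (vs ! Suc l)"
    have cn: "c \<noteq> \<alpha>" "c \<noteq> \<beta>" using ok_interior[OF o lm(1,2) mc] by auto
    obtain \<mu> y where mu: "\<mu> \<notin> used \<psi>" "\<mu> \<noteq> \<beta>" "\<mu> \<noteq> \<alpha>" "y \<in> W" "miss \<psi> \<mu> y" "\<mu> \<in> missW \<psi>"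
      using free_colour[OF o] .
    \<comment> \<open>The next swaps involve a colour not missing on \<open>W\<close>, whose chains
      may enter \<open>W\<close>, so the partner must be absent from \<open>T\<close>. As
      \<open>c\<close> is missing on \<open>W\<close>, it can be exchanged for such a \<mu> by a
      swap outside \<open>W\<close>.\<close>
    have "\<exists>\<psi>1. ok \<psi>1 \<and> used \<psi>1 = used \<psi> \<and> miss \<psi>1 \<mu> y \<and> miss \<psi>1 \<mu> (vs ! Suc l)"
    proof (cases "c = \<mu>")
      case True thus ?thesis using o mu mc by blast
    next
      case False
      note K = good_kswap_outside[OF ok_good[OF o] cM mu(6) False notW(2)]
      have "miss (kswap \<psi> c \<mu> (vs ! Suc l)) \<mu> (vs ! Suc l)"
        using miss_kswap_in[OF vcomp_self] mc miss_range[OF mc] miss_range[OF mu(5)] by blast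
      thus ?thesis using ok_kswap[OF o K(1,2) cn mu(3,2)] K(2) K(3)[OF mu(4)] mu(5) by blast
    qed
    then obtain \<psi>1 where o1: "ok \<psi>1" and u1: "used \<psi>1 = used \<psi>" and m1: "miss \<psi>1 \<mu> y"
      and s1: "miss \<psi>1 \<mu> (vs ! Suc l)" by blast
    have muM: "\<mu> \<in> missW \<psi>1" using m1 mu(4) by (auto simp: missing_colours_def)
    note gd1 = ok_good[OF o1]
    have "vs ! l \<in> V"
    proof -
      have "es ! l \<in> E" "vs ! l \<in> ends (es ! l)" using P lm m by (auto simp: alt_path_def)
      thus ?thesis using ends_subset_V by blast
    qed
    then obtain \<delta> where d: "miss \<psi>1 \<delta> (vs ! l)" using ex_missing[OF good_R[OF gd1]] by blast
    have dM: "\<delta> \<notin> missW \<psi>1" using IH[OF o1] d by blast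
    have dn: "\<delta> \<noteq> \<alpha>" "\<delta> \<noteq> \<beta>" using ok_interior[OF o1 step.hyps(1) lm(3) d] by auto
    have un: "\<delta> \<notin> used \<psi>1" "\<mu> \<notin> used \<psi>1" using dM used_missW[OF gd1] mu(1) u1 by auto
    have dm: "\<delta> \<noteq> \<mu>" using dM muM by auto
    have r: "\<delta> \<in> {1..k}" "\<mu> \<in> {1..k}" using miss_range d m1 by blast+
    \<comment> \<open>Otherwise a swap at \<open>vs ! l\<close> would give the predecessor a colour
      missing at \<open>y\<close>, against the induction hypothesis. So \<open>vs ! l\<close> and
      \<open>y\<close> are the ends of their chain, and \<open>vs ! Suc l\<close> is free to trade
      \<mu> for \<delta>.\<close>
    have chain: "y \<in> vcomp \<psi>1 \<delta> \<mu> (vs ! l)"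
    proof (rule ccontr)
      assume out: "y \<notin> vcomp \<psi>1 \<delta> \<mu> (vs ! l)"
      note K = good_kswap_unused[OF gd1 r dm un, of "vs ! l"]
      have o2: "ok (kswap \<psi>1 \<delta> \<mu> (vs ! l))" using ok_kswap[OF o1 K dn mu(3,2)] .
      have "miss (kswap \<psi>1 \<delta> \<mu> (vs ! l)) \<mu> y" using miss_kswap_out[OF out] m1 by simp
      hence "\<mu> \<in> missW (kswap \<psi>1 \<delta> \<mu> (vs ! l))" using mu(4) by (auto simp: missing_colours_def)
      moreover have "miss (kswap \<psi>1 \<delta> \<mu> (vs ! l)) \<mu> (vs ! l)" using miss_kswap_in[OF vcomp_self r] d by blast
      ultimately show False using IH[OF o2] by blast
    qed
    have ynl: "vs ! l \<noteq> y" "y \<noteq> vs ! Suc l" using notW mu(4) by auto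
    note out = vcomp_other_end[OF good_proper[OF gd1] r dm disjI1[OF d] disjI2[OF m1] disjI2[OF s1]
        ynl(1) dist2 ynl(2) chain]
    let ?\<psi> = "kswap \<psi>1 \<delta> \<mu> (vs ! Suc l)"
    note K = good_kswap_unused[OF gd1 r dm un, of "vs ! Suc l"]
    have o3: "ok ?\<psi>" using ok_kswap[OF o1 K dn mu(3,2)] .
    have 1: "miss ?\<psi> \<delta> (vs ! l)" using miss_kswap_out[OF out(1)] d by simp
    have 2: "miss ?\<psi> \<delta> (vs ! Suc l)" using miss_kswap_in[OF vcomp_self r] s1 by blast
    have "\<delta> \<notin> missW ?\<psi>" using IH[OF o3] 1 by blast
    thus False using consecutive_no_common[OF o3 step.hyps(1) lm(2) 1 2] by blast
  qed
qed

text \<open>If two segment vertices miss the same \<open>c\<close>, the chain of each in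
  \<open>c\<close> and \<mu> must reach the vertex \<open>y\<close> of \<open>W\<close>, or a swap
  would make a segment vertex miss \<mu> along with \<open>y\<close>. That would put three ends on
  one chain.\<close>

lemma segment_elementary: "elementary E ends k \<phi> (W \<union> {vs ! l | l. i \<le> l \<and> l \<le> m})"
proof -
  have WQ: False if "x \<in> W" "i \<le> l" "l \<le> m" "miss \<phi> c x" "miss \<phi> c (vs ! l)" for x l c
    using segment_no_missW[OF that(2,3) ok_self, of c] that by (auto simp: missing_colours_def)
  have QQ: False
    if l: "i \<le> l" "l \<le> m" "i \<le> l'" "l' \<le> m" and nel: "vs ! l \<noteq> vs ! l'"
      and c: "miss \<phi> c (vs ! l)" "miss \<phi> c (vs ! l')" for l l' c
  proof -
    obtain \<mu> y where mu: "\<mu> \<notin> used \<phi>" "\<mu> \<noteq> \<beta>" "\<mu> \<noteq> \<alpha>" "y \<in> W" "miss \<phi> \<mu> y" "\<mu> \<in> missW \<phi>"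
      using free_colour[OF ok_self] .
    have cM: "c \<notin> missW \<phi>" using segment_no_missW[OF l(1,2) ok_self] c(1) by blast
    have cn: "c \<noteq> \<alpha>" "c \<noteq> \<beta>" using ok_interior[OF ok_self l(1,2) c(1)] by auto
    have cu: "c \<notin> used \<phi>" "c \<noteq> \<mu>" using cM used_missW[OF g] mu(6) by auto
    have r: "c \<in> {1..k}" "\<mu> \<in> {1..k}" using miss_range c mu(5) by blast+
    have *: "y \<in> vcomp \<phi> c \<mu> (vs ! j)" if j: "i \<le> j" "j \<le> m" "miss \<phi> c (vs ! j)" for j
    proof (rule ccontr)
      assume out: "y \<notin> vcomp \<phi> c \<mu> (vs ! j)"
      note K = good_kswap_unused[OF g r cu(2,1) mu(1), of "vs ! j"]
      have o: "ok (kswap \<phi> c \<mu> (vs ! j))" using ok_kswap[OF ok_self K cn mu(3,2)] .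
      have "miss (kswap \<phi> c \<mu> (vs ! j)) \<mu> y" using miss_kswap_out[OF out] mu(5) by simp
      hence "\<mu> \<in> missW (kswap \<phi> c \<mu> (vs ! j))" using mu(4) by (auto simp: missing_colours_def)
      moreover have "miss (kswap \<phi> c \<mu> (vs ! j)) \<mu> (vs ! j)" using miss_kswap_in[OF vcomp_self r] j(3) by blast
      ultimately show False using segment_no_missW[OF j(1,2) o] by blast
    qed
    have "vs ! l \<noteq> y" "y \<noteq> vs ! l'" using outW l mu(4) by auto
    from vcomp_other_end(2)[OF good_proper[OF g] r cu(2) disjI1[OF c(1)] disjI2[OF mu(5)] disjI1[OF c(2)]
        this(1) nel this(2) *[OF l(1,2) c(1)]]
    show False using *[OF l(3,4) c(2)] by blast
  qed
  show ?thesis unfolding elementary_def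
  proof (intro ballI impI notI)
    fix x y assume xy: "x \<in> W \<union> {vs ! l | l. i \<le> l \<and> l \<le> m}" "y \<in> W \<union> {vs ! l | l. i \<le> l \<and> l \<le> m}" "x \<noteq> y"
      and "\<exists>c. miss \<phi> c x \<and> miss \<phi> c y"
    then obtain c where c: "miss \<phi> c x" "miss \<phi> c y" by blast
    show False using xy c WQ QQ elementaryD[OF good_elementary[OF g], of x y c] by blast
  qed
qed

end

context maximum_tashkinov_tree
begin

section \<open>Statements (b) and (c)\<close>

lemma maximal_path_from_W:
  assumes g: "good \<phi>" and u: "u \<in> W" "miss \<phi> \<beta> u" and b: "\<beta> \<notin> used \<phi>"
    and a: "defective E ends \<phi> W \<alpha>" and P: "maximal_alt_path_from E ends \<phi> \<alpha> \<beta> u vs es"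
  shows "es \<noteq> []" "miss \<phi> \<alpha> (vs ! length es) \<or> miss \<phi> \<beta> (vs ! length es)"
    "boundary_edges E ends \<phi> W \<alpha> \<subseteq> set es"
proof -
  have P: "alt_path E ends \<phi> \<alpha> \<beta> vs es" "vs ! 0 = u"
    and max: "\<not> (\<exists>w e. alt_path E ends \<phi> \<alpha> \<beta> (vs @ [w]) (es @ [e]))"
    using P by (auto simp: maximal_alt_path_from_def)
  have fst: "miss \<phi> \<alpha> (vs ! 0) \<or> miss \<phi> \<beta> (vs ! 0)" using u P by simp
  note pr = good_proper[OF g]
  show ne: "es \<noteq> []" using maximal_path_nonempty[OF g u(1) a P max] .
  show lst: "miss \<phi> \<alpha> (vs ! length es) \<or> miss \<phi> \<beta> (vs ! length es)"
    using maximal_alt_path_last[OF pr P(1) defective_not_missW(2)[OF g a] miss_range[OF u(2)] fst max] .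
  show "boundary_edges E ends \<phi> W \<alpha> \<subseteq> set es" using boundary_subset_path[OF g u b P ne lst] .
qed

lemma exit_segment_elementary:
  assumes g: "good \<phi>" and u: "u \<in> W" "miss \<phi> \<beta> u" and b: "\<beta> \<notin> used \<phi>"
    and a: "defective E ends \<phi> W \<alpha>" and P: "maximal_alt_path_from E ends \<phi> \<alpha> \<beta> u vs es"
    and m: "i \<le> m" "m < length vs"
    and inW: "\<And>j. j < i \<Longrightarrow> vs ! j \<in> W" and outW: "\<And>j. i \<le> j \<Longrightarrow> j \<le> m \<Longrightarrow> vs ! j \<notin> W"
  shows "elementary E ends k \<phi> (W \<union> {vs ! l | l. i \<le> l \<and> l \<le> m})"
proof -
  have P': "alt_path E ends \<phi> \<alpha> \<beta> vs es" "vs ! 0 = u"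
    using P by (auto simp: maximal_alt_path_from_def)
  have len: "length vs = Suc (length es)" using P' by (simp add: alt_path_def)
  \<comment> \<open>If the segment reached the end of the path, the path would leave
    \<open>W\<close> only once.\<close>
  have "m < length es"
  proof (rule ccontr)
    assume "\<not> m < length es"
    hence "m = length es" using m len by simp
    thus False
      using no_single_exit[OF g u b a P' maximal_path_from_W(1,2)[OF g u b a P], of i] inW outW len by simp
  qed
  hence "exit_segment V E ends k e0 R T W \<phi> \<alpha> \<beta> u vs es i m"
    using g u b a P' m(1) inW outW by unfold_locales
  then interpret exit_segment V E ends k e0 R T W \<phi> \<alpha> \<beta> u vs es i m .
  show ?thesis by (rule segment_elementary)
qed

text \<open>The two vertices are consecutive: were the path back in \<open>W\<close> right after
  \<open>vs ! i\<close>, both path edges at \<open>vs ! i\<close> would cross the boundary. \<beta>,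
  being missing on \<open>W\<close>, does not cross it, so both would be coloured \<alpha>, against
  alternation.\<close>

lemma first_two_exits_elementary:
  assumes g: "good \<phi>" and u: "u \<in> W" "miss \<phi> \<beta> u" and b: "\<beta> \<notin> used \<phi>"
    and a: "defective E ends \<phi> W \<alpha>" and P: "maximal_alt_path_from E ends \<phi> \<alpha> \<beta> u vs es"
    and ij: "i < j" "j < length vs" "vs ! i \<notin> W" "vs ! j \<notin> W"
    and inW: "\<And>l. l < j \<Longrightarrow> l \<noteq> i \<Longrightarrow> vs ! l \<in> W"
  shows "elementary E ends k \<phi> (W \<union> {vs ! i, vs ! j})"
proof -
  have P': "alt_path E ends \<phi> \<alpha> \<beta> vs es" "vs ! 0 = u"
    using P by (auto simp: maximal_alt_path_from_def)
  have len: "length vs = Suc (length es)" using P' by (simp add: alt_path_def)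
  have bM: "\<beta> \<in> missW \<phi>" using u by (auto simp: missing_colours_def)
  obtain i' where i': "i = Suc i'" using ij P' u by (cases i) auto
  have "j = Suc i"
  proof (rule ccontr)
    assume "j \<noteq> Suc i"
    hence W: "vs ! Suc i \<in> W" "vs ! i' \<in> W" using inW ij i' by auto
    have e: "es ! l \<in> E" "ends (es ! l) = {vs ! l, vs ! Suc l}" "\<phi> (es ! l) = Some \<alpha> \<or> \<phi> (es ! l) = Some \<beta>"
      if "l < length es" for l using P' that by (auto simp: alt_path_def)
    have l: "i' < length es" "i < length es" using ij len i' by auto
    have "\<phi> (es ! i') = Some \<alpha>"
      using e[OF l(1)] good_closed[OF g W(2) e(1)[OF l(1)] _ _ bM] i' ij(3) by auto
    moreover have "\<phi> (es ! i) = Some \<alpha>"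
      using e[OF l(2)] good_closed[OF g W(1) e(1)[OF l(2)] _ _ bM] ij(3) by auto
    moreover have "\<phi> (es ! i') \<noteq> \<phi> (es ! i)" using P' l i' by (simp add: alt_path_def)
    ultimately show False by simp
  qed
  moreover from this have "{vs ! l | l. i \<le> l \<and> l \<le> j} = {vs ! i, vs ! j}"
    by (auto simp: le_Suc_eq)
  moreover have "elementary E ends k \<phi> (W \<union> {vs ! l | l. i \<le> l \<and> l \<le> j})"
    by (rule exit_segment_elementary[OF g u b a P])
      (use ij inW \<open>j = Suc i\<close> in \<open>auto simp: le_Suc_eq\<close>)
  ultimately show ?thesis by simp
qed

end

theorem theorem2:
  fixes V :: "'v set" and E :: "'e set" and ends :: "'e \<Rightarrow> 'v set"
    and k :: nat and \<phi> :: "'e \<Rightarrow> nat option" and e0 :: 'e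
    and T :: "('e \<times> 'v) list"
  defines "W \<equiv> tashkinov_W E ends k \<phi> e0"
  assumes G: "loopless_multigraph V E ends"
    and chi: "chromatic_index E ends \<ge> max_degree V E ends + 2"
    and col: "partial_edge_colouring E ends k \<phi>"
    and kge: "k \<ge> max_degree V E ends + 1"
    and e0: "e0 \<in> E" "\<phi> e0 = None"
    and T: "maximal_tashkinov_tree E ends k \<phi> e0 T"
    and not1: "\<not> (\<exists>\<phi>'. (kempe_change E ends k)\<^sup>*\<^sup>* \<phi> \<phi>' \<and> partial_edge_colouring E ends k \<phi>' \<and>
                  (\<exists>c. \<forall>x\<in>ends e0. missing E ends k \<phi>' c x))"
    and not2: "\<not> (\<exists>\<phi>'. (kempe_change E ends k)\<^sup>*\<^sup>* \<phi> \<phi>' \<and> partial_edge_colouring E ends k \<phi>' \<and>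
                  card (tashkinov_W E ends k \<phi>' e0) > card W)"
    and not3: "\<not> (of_nat (chromatic_index E ends) \<ge> \<lceil>rho W (induced_edges E ends W) ends\<rceil> \<and>
                  \<lceil>rho W (induced_edges E ends W) ends\<rceil> > int k)"
  shows
    \<comment> \<open>(a)\<close>
    "(elementary E ends k \<phi> W \<and> defective_colours E ends \<phi> W \<noteq> {} \<and>
      (\<forall>\<gamma>\<in>defective_colours E ends \<phi> W. odd (card (boundary_edges E ends \<phi> W \<gamma>))))
     \<and>
     \<comment> \<open>(b) and (c)\<close>
     (\<forall>\<alpha> \<beta> u vs es.
        \<beta> \<in> missing_colours E ends k \<phi> W - tree_colours \<phi> e0 T \<and>
        \<alpha> \<in> defective_colours E ends \<phi> W \<and>
        u \<in> W \<and> missing E ends k \<phi> \<beta> u \<and>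
        maximal_alt_path_from E ends \<phi> \<alpha> \<beta> u vs es \<longrightarrow>
          (boundary_edges E ends \<phi> W \<alpha> \<subseteq> set es) \<and>
          (\<forall>i j. i < j \<and> j < length vs \<and> vs ! i \<notin> W \<and> vs ! j \<notin> W \<and>
                 (\<forall>l<j. l \<noteq> i \<longrightarrow> vs ! l \<in> W) \<longrightarrow>
                 elementary E ends k \<phi> (W \<union> {vs ! i, vs ! j})) \<and>
          (\<forall>i m. i \<le> m \<and> m < length vs \<and> (\<forall>l<i. vs ! l \<in> W) \<and>
                 (\<forall>l. i \<le> l \<and> l \<le> m \<longrightarrow> vs ! l \<notin> W) \<and>
                 (Suc m < length vs \<longrightarrow> vs ! Suc m \<in> W) \<longrightarrow>
                 elementary E ends k \<phi> (W \<union> {vs ! l | l. i \<le> l \<and> l \<le> m})))"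
proof -
  let ?R = "(kempe_change E ends k)\<^sup>*\<^sup>* \<phi>"
  interpret multigraph V E ends k by unfold_locales (rule G)
  have R: "partial_edge_colouring E ends k \<psi> \<and> \<psi> e0 = None" if "?R \<psi>" for \<psi>
    using kempe_reachable_proper[OF that col] e0 by simp
  interpret kempe_class V E ends k e0 ?R
  proof unfold_locales
    fix \<psi> a b v assume "?R \<psi>" "a \<in> {1..k}" "b \<in> {1..k}" "a \<noteq> b"
    thus "?R (kswap \<psi> a b v)" using kswap_reachable by (meson rtranclp_trans)
  next
    fix \<psi> c assume "?R \<psi>"
    thus "\<exists>x\<in>ends e0. \<not> missing E ends k \<psi> c x" using not1 R by blast
  qed (use R e0 kge in auto)
  have T': "tashkinov_tree E ends k \<phi> e0 T" using T by (simp add: maximal_tashkinov_tree_def)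
  have TW: "tree_vertices ends e0 T = W"
    unfolding W_def using tree_vertices_subset_W[OF T'] W_subset_maximal_tree[OF T] by blast
  interpret maximum_tashkinov_tree V E ends k e0 ?R T W
  proof unfold_locales
    fix \<psi> assume "?R \<psi>"
    thus "card (tashkinov_W E ends k \<psi> e0) \<le> card W" using not2 R by (meson not_le)
  qed (rule TW)
  have g: "good \<phi>" using T' by (simp add: good_def)
  have "\<lceil>rho W (induced_edges E ends W) ends\<rceil> \<le> int (chromatic_index E ends)"
    using rho_le_chromatic_index[OF finite_W] by (simp add: ceiling_le_iff)
  hence "\<lceil>rho W (induced_edges E ends W) ends\<rceil> \<le> int k" using not3 by simp
  hence rho: "rho W (induced_edges E ends W) ends \<le> real k" by (simp add: ceiling_le_iff)
  show ?thesis
  proof (intro conjI allI impI; (elim conjE)?)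
    show "elementary E ends k \<phi> W" by (rule good_elementary[OF g])
    show "defective_colours E ends \<phi> W \<noteq> {}" by (rule ex_defective[OF g rho])
    show "\<forall>\<gamma>\<in>defective_colours E ends \<phi> W. odd (card (boundary_edges E ends \<phi> W \<gamma>))"
      using odd_defective[OF g] by (simp add: defective_colours_def)
  next
    fix \<alpha> \<beta> u vs es
    assume h: "\<beta> \<in> missW \<phi> - used \<phi>" "\<alpha> \<in> defective_colours E ends \<phi> W" "u \<in> W" "miss \<phi> \<beta> u"
      "maximal_alt_path_from E ends \<phi> \<alpha> \<beta> u vs es"
    hence b: "\<beta> \<notin> used \<phi>" and a: "defective E ends \<phi> W \<alpha>" by (auto simp: defective_colours_def)
    show "boundary_edges E ends \<phi> W \<alpha> \<subseteq> set es" using maximal_path_from_W(3)[OF g h(3,4) b a h(5)] .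
    show "elementary E ends k \<phi> (W \<union> {vs ! i, vs ! j})"
      if "i < j" "j < length vs" "vs ! i \<notin> W" "vs ! j \<notin> W" "\<forall>l<j. l \<noteq> i \<longrightarrow> vs ! l \<in> W" for i j
      using first_two_exits_elementary[OF g h(3,4) b a h(5) that(1-4)] that(5) by blast
    show "elementary E ends k \<phi> (W \<union> {vs ! l | l. i \<le> l \<and> l \<le> m})"
      if "i \<le> m" "m < length vs" "\<forall>l<i. vs ! l \<in> W" "\<forall>l. i \<le> l \<and> l \<le> m \<longrightarrow> vs ! l \<notin> W" for i m
      using exit_segment_elementary[OF g h(3,4) b a h(5) that(1,2)] that(3,4) by blast
  qed
qed

end
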